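(* (1) Let $H_1,H_2$ be graphs with $v(H_1)\leq v(H_2)$ such that every set of $v(H_1)$ vertices of $H_2$ contains a copy of $H_1$ as a subgraph. Then $C(H_1,H_2)=\frac{v(H_1)}{v(H_2)}$. (2) Let $H$ be a graph for which there exist vertex-disjoint paths $P_{\ell_1},\ldots,P_{\ell_k}$, each with $\ell_i\geq 2$ edges, that are subgraphs of $H$ with $V(H)=\bigsqcup_{i=1}^k V(P_{\ell_i})$. Then $C(P_2,H)=\frac{3}{v(H)}$. (3) For every graph $H$, $C(K_2,H)=\nu^*(H)^{-1}$. (4) If $H_1$ is a (not necessarily spanning) subgraph of $H_2$ and $\nu^*(H_1)=\nu^*(H_2)$, then $C(H_1,H_2)=1$.
   Context: All graphs are finite and simple; $v(\cdot)$ is the number of vertices. $P_m$ denotes the path with $m$ edges and $K_2$ the single edge. $\nu^*(H)$ denotes the fractional matching number of $H$. $\operatorname{hom}(H,T)$ is the number of maps $V(H)\to V(T)$ sending every edge of $H$ to an edge of $T$, $t(H,T)=\operatorname{hom}(H,T)/v(T)^{v(H)}$, and $C(G,H)=\min\{c\in\mathbb{R}: t(G,T)\geq t(H,T)^c \text{ for all graphs } T\}$.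
   Formalization: In (1), H_1 is assumed to have no isolated vertices (the claim fails for H_1=K_2+K_1, H_2=2K_2); in (3), H is assumed to have an edge (else ν*=0); in (4), H_1 is assumed to have an edge (else the minimum does not exist); graphs have at least one vertex. *)

theory Defs
  imports
    Complex_Main
    "HOL-Library.FuncSet"
    "HOL-Library.Disjoint_Sets"
    "Graph_Theory.Pair_Digraph"
    "Graph_Theory.Digraph_Isomorphism"
begin

text \<open>
  Finite simple graphs are the symmetric loop-free pair digraphs of \<^locale>\<open>pair_graph\<close>, which
  allows the null graph. The null graph is excluded here, so that homomorphism densities into any
  graph are defined.
\<close>

definition simple_graph :: "'a pair_pre_digraph \<Rightarrow> bool" where
  "simple_graph G \<longleftrightarrow> pair_graph G \<and> pverts G \<noteq> {}"

definition nverts :: "'a pair_pre_digraph \<Rightarrow> nat" where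
  "nverts G = card (pverts G)"

text \<open>An undirected edge corresponds to two opposite arcs.\<close>

definition edges :: "'a pair_pre_digraph \<Rightarrow> 'a set set" where
  "edges G = {{x, y} | x y. (x, y) \<in> parcs G}"

text \<open>
  Isolated vertices of \<open>H\<close> change \<open>v(H)\<close> but no density: \<open>K\<^sub>2 + K\<^sub>1\<close> and \<open>2K\<^sub>2\<close> satisfy the copy condition of
  the first claim (any 3 vertices of \<open>2K\<^sub>2\<close> span an edge), yet \<open>C(K\<^sub>2 + K\<^sub>1, 2K\<^sub>2) = 1/2 \<noteq> 3/4\<close>.
  Hence that claim is about graphs \<open>H\<^sub>1\<close> without isolated vertices.
\<close>

definition no_isolated_vertex :: "'a pair_pre_digraph \<Rightarrow> bool" where
  "no_isolated_vertex G \<longleftrightarrow> (\<forall>x \<in> pverts G. \<exists>y. (x, y) \<in> parcs G)"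

definition is_subgraph :: "'a pair_pre_digraph \<Rightarrow> 'a pair_pre_digraph \<Rightarrow> bool" where
  "is_subgraph K H \<longleftrightarrow> subgraph (with_proj K) (with_proj H)"

definition isomorphic :: "'a pair_pre_digraph \<Rightarrow> 'b pair_pre_digraph \<Rightarrow> bool" where
  "isomorphic G H \<longleftrightarrow> digraph_iso (with_proj G) (with_proj H)"

definition contains_copy :: "'b pair_pre_digraph \<Rightarrow> 'b set \<Rightarrow> 'a pair_pre_digraph \<Rightarrow> bool" where
  "contains_copy H S G \<longleftrightarrow> (\<exists>K. is_subgraph K H \<and> pverts K \<subseteq> S \<and> isomorphic G K)"

definition path_graph :: "nat \<Rightarrow> nat pair_pre_digraph" where
  "path_graph m = \<lparr> pverts = {0..m},
     parcs = {(i, j). i \<le> m \<and> j \<le> m \<and> (j = Suc i \<or> i = Suc j)} \<rparr>"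

definition K2 :: "nat pair_pre_digraph" where
  "K2 = \<lparr> pverts = {0, 1}, parcs = {(0, 1), (1, 0)} \<rparr>"

definition hom_count :: "'a pair_pre_digraph \<Rightarrow> 'b pair_pre_digraph \<Rightarrow> nat" where
  "hom_count H T = card {\<phi> \<in> pverts H \<rightarrow>\<^sub>E pverts T. \<forall>(x, y) \<in> parcs H. (\<phi> x, \<phi> y) \<in> parcs T}"

definition hom_density :: "'a pair_pre_digraph \<Rightarrow> 'b pair_pre_digraph \<Rightarrow> real" where
  "hom_density H T = real (hom_count H T) / real (nverts T) ^ nverts H"

definition fractional_matching :: "'a pair_pre_digraph \<Rightarrow> ('a set \<Rightarrow> real) \<Rightarrow> bool" where
  "fractional_matching G f \<longleftrightarrow>
     (\<forall>e \<in> edges G. 0 \<le> f e) \<and> (\<forall>x \<in> pverts G. (\<Sum>e \<in> {e \<in> edges G. x \<in> e}. f e) \<le> 1)"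

definition fractional_matching_number :: "'a pair_pre_digraph \<Rightarrow> real" where
  "fractional_matching_number G = Sup {\<Sum>e \<in> edges G. f e | f. fractional_matching G f}"

text \<open>
  Target graphs may be taken to have vertices in \<^typ>\<open>nat\<close>, since every finite graph is
  isomorphic to such a graph. \<^const>\<open>powr\<close> sets \<open>0 powr c = 0\<close> for all \<open>c\<close>; when \<open>G\<close> and \<open>H\<close> both
  have an edge, this is harmless for \<open>c \<le> 0\<close>: a complete target \<open>T\<close> on sufficiently many
  vertices has \<open>0 < hom_density H T\<close> and \<open>hom_density G T < 1 \<le> hom_density H T powr c\<close>, so no such \<open>c\<close> is an element.
\<close>

definition domination_exponents :: "'a pair_pre_digraph \<Rightarrow> 'b pair_pre_digraph \<Rightarrow> real set" where
  "domination_exponents G H =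
     {c. \<forall>T :: nat pair_pre_digraph. simple_graph T \<longrightarrow> hom_density G T \<ge> hom_density H T powr c}"

text \<open>
  The equation \<open>C(G,H) = c\<close>, where \<open>C(G,H)\<close> is a minimum: it includes that the minimum is attained.
\<close>

definition has_domination_exponent ::
  "'a pair_pre_digraph \<Rightarrow> 'b pair_pre_digraph \<Rightarrow> real \<Rightarrow> bool" where
  "has_domination_exponent G H c \<longleftrightarrow>
     c \<in> domination_exponents G H \<and> (\<forall>c' \<in> domination_exponents G H. c \<le> c')"

end

theory Submission
  imports Defs
begin

text \<open>
  All upper bounds on the exponents come from one inequality, a form of Finner's inequality: if subgraphs
  \<open>K j\<close> of \<open>H\<close> carry nonnegative weights \<open>w j\<close> that add up to at most 1 at every vertex of \<open>H\<close>, then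
  \<open>t(H,T) \<le> (\<Prod>j. t(K j,T) powr w j)\<close>. The four claims use, respectively, all vertex subsets of size \<open>v(H\<^sub>1)\<close>
  with equal weights, the given paths (together with \<open>t(P\<^sub>l,T)\<^sup>3 \<le> t(P\<^sub>2,T) ^ (l + 1)\<close>), the edges weighted by a
  fractional matching, and the single subgraph \<open>H\<^sub>1\<close>.

  The lower bounds come from two families of targets. A clique padded with isolated vertices shows that the exponent
  is at least the ratio of the vertex numbers. For the fractional matching number, a minimum fractional
  vertex cover, half-integral by Koenig's theorem on the bipartite double cover, prescribes a target of edge
  density \<open>O(\<epsilon>)\<close> in which \<open>H\<close> has density of order at least \<open>\<epsilon> powr \<nu>\<^sup>*(H)\<close>.
\<close>

section \<open>Finner's inequality\<close>

text \<open>The missing weight \<open>1 - (\<Sum>j\<in>J. w j)\<close> is treated as the weight of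
  an additional value 1. With \<open>s\<close> the logarithm of the weighted geometric mean, the
  bound is the weighted sum of the tangent estimates \<open>exp s * (u - s + 1) \<le> exp u\<close>
  at \<open>u = ln (y j)\<close>.\<close>

lemma weighted_am_gm:
  fixes y w :: "'j \<Rightarrow> real"
  assumes fin: "finite J" and w: "\<And>j. j \<in> J \<Longrightarrow> 0 \<le> w j" and W: "(\<Sum>j\<in>J. w j) \<le> 1"
    and y: "\<And>j. j \<in> J \<Longrightarrow> 0 \<le> y j"
  shows "(\<Prod>j\<in>J. y j powr w j) \<le> (\<Sum>j\<in>J. w j * y j) + (1 - (\<Sum>j\<in>J. w j))"
proof (cases "\<exists>j\<in>J. y j = 0")
  case True
  then have "(\<Prod>j\<in>J. y j powr w j) = 0"
    using fin by (auto intro!: prod_zero)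
  moreover have "0 \<le> (\<Sum>j\<in>J. w j * y j)"
    using w y by (intro sum_nonneg) auto
  ultimately show ?thesis using W by simp
next
  case False
  then have pos: "0 < y j" if "j \<in> J" for j
    using y[OF that] that by force
  define s where "s = (\<Sum>j\<in>J. w j * ln (y j))"
  define V where "V = (\<Sum>j\<in>J. w j)"
  have M: "(\<Prod>j\<in>J. y j powr w j) = exp s"
    unfolding s_def exp_sum[OF fin] by (intro prod.cong refl) (use pos in \<open>force simp: powr_def\<close>)
  have "exp s * (w j * (ln (y j) - s + 1)) \<le> w j * y j" if "j \<in> J" for j
  proof -
    have "1 + (ln (y j) - s) \<le> exp (ln (y j) - s)"
      by (rule exp_ge_add_one_self)
    then have "1 + (ln (y j) - s) \<le> y j / exp s"
      using pos[OF that] by (simp add: exp_diff)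
    then have "exp s * (1 + (ln (y j) - s)) \<le> y j"
      by (simp add: field_simps)
    from mult_left_mono[OF this w[OF that]] show ?thesis by (simp add: algebra_simps)
  qed
  then have "(\<Sum>j\<in>J. exp s * (w j * (ln (y j) - s + 1))) \<le> (\<Sum>j\<in>J. w j * y j)"
    by (rule sum_mono)
  moreover have "(\<Sum>j\<in>J. exp s * (w j * (ln (y j) - s + 1))) = exp s * (s + V * (1 - s))"
    proof -
    have "(\<Sum>j\<in>J. w j * (ln (y j) - s + 1)) = s - V * s + V"
      by (simp add: V_def s_def[symmetric] sum_distrib_right distrib_left right_diff_distrib sum.distrib sum_subtractf)
    then show ?thesis
      by (simp only: sum_distrib_left[symmetric]) (simp add: algebra_simps)
  qed
  \<comment> \<open>This is the same tangent estimate for the additional value 1, whose logarithm is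
    0.\<close>
  moreover have "(1 - V) * (exp s * (1 - s)) \<le> (1 - V) * 1"
  proof (rule mult_left_mono)
    have "1 + (- s) \<le> exp (- s)"
      by (rule exp_ge_add_one_self)
    from mult_left_mono[OF this, of "exp s"] show "exp s * (1 - s) \<le> 1"
      by (simp add: exp_minus)
  qed (use W V_def in simp)
  ultimately show ?thesis
    unfolding M V_def[symmetric] by (simp add: algebra_simps)
qed

text \<open>Divide each \<open>g j\<close> by its average \<open>a j\<close>, apply weighted AM-GM
  at every point and average over \<open>X\<close>. Averages instead of sums make total weights
  below 1 admissible. If some \<open>a j\<close> is 0, then \<open>g j\<close> vanishes on
  \<open>X\<close> and so does the left-hand side.\<close>

lemma Hoelder_average:
  fixes g :: "'j \<Rightarrow> 'x \<Rightarrow> real" and w :: "'j \<Rightarrow> real"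
  assumes finX: "finite X" and fin: "finite J" and w: "\<And>j. j \<in> J \<Longrightarrow> 0 \<le> w j"
    and W: "(\<Sum>j\<in>J. w j) \<le> 1"
    and g: "\<And>j x. j \<in> J \<Longrightarrow> x \<in> X \<Longrightarrow> 0 \<le> g j x"
  shows "(\<Sum>x\<in>X. \<Prod>j\<in>J. g j x powr w j) / card X \<le> (\<Prod>j\<in>J. ((\<Sum>x\<in>X. g j x) / card X) powr w j)"
proof (cases "X = {}")
  case True
  then show ?thesis by (simp add: prod_nonneg)
next
  case False
  define n where "n = real (card X)"
  have n: "0 < n" using False finX by (simp add: n_def card_gt_0_iff)
  define a where "a j = (\<Sum>x\<in>X. g j x) / n" for j
  have a0: "0 \<le> a j" if "j \<in> J" for j
    unfolding a_def using g[OF that] n by (intro divide_nonneg_pos sum_nonneg) auto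
  show ?thesis
  proof (cases "\<exists>j\<in>J. a j = 0")
    case True
    then obtain i where i: "i \<in> J" "a i = 0" by blast
    then have "\<forall>x\<in>X. g i x = 0"
      using n g[OF i(1)] finX by (simp add: a_def sum_nonneg_eq_0_iff)
    then have "(\<Prod>j\<in>J. g j x powr w j) = 0" if "x \<in> X" for x
      using fin i(1) that by (intro prod_zero) auto
    then show ?thesis by (simp add: prod_nonneg)
  next
    case False
    with a0 have a: "0 < a j" if "j \<in> J" for j
      using that by force
    define P where "P = (\<Prod>j\<in>J. a j powr w j)"
    have P: "0 < P" unfolding P_def using a by (intro prod_pos) force
    have "(\<Prod>j\<in>J. g j x powr w j) = P * (\<Prod>j\<in>J. (g j x / a j) powr w j)" if "x \<in> X" for x
      unfolding P_def prod.distrib[symmetric]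
      by (intro prod.cong refl) (use a g that in \<open>simp add: powr_divide\<close>, force)
    moreover have "(\<Prod>j\<in>J. (g j x / a j) powr w j) \<le> (\<Sum>j\<in>J. w j * (g j x / a j)) + (1 - sum w J)"
      if "x \<in> X" for x
      using g a that by (intro weighted_am_gm fin w W divide_nonneg_pos) auto
    ultimately have "(\<Sum>x\<in>X. \<Prod>j\<in>J. g j x powr w j)
        \<le> (\<Sum>x\<in>X. P * ((\<Sum>j\<in>J. w j * (g j x / a j)) + (1 - sum w J)))"
      using P by (intro sum_mono) simp
    also have "\<dots> = P * ((\<Sum>j\<in>J. w j * ((\<Sum>x\<in>X. g j x) / a j)) + n * (1 - sum w J))"
      unfolding sum_distrib_left[symmetric] sum.distrib sum.swap[of _ J X]
      by (simp add: sum_divide_distrib sum_distrib_left n_def)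
    also have "(\<Sum>j\<in>J. w j * ((\<Sum>x\<in>X. g j x) / a j)) = (\<Sum>j\<in>J. w j * n)"
      using a n by (intro sum.cong refl) (force simp: a_def)
    finally have "(\<Sum>x\<in>X. \<Prod>j\<in>J. g j x powr w j) \<le> P * n"
      by (simp add: sum_distrib_right[symmetric]) (simp add: algebra_simps)
    then show ?thesis
      using n by (simp add: P_def a_def n_def divide_le_eq)
  qed
qed

text \<open>Hoelder with three weights 1/3. As these add up to exactly 1, the normalising factors
  \<open>card X\<close> cancel and plain sums can be compared; the cubes keep roots out of the
  applications to walks.\<close>

lemma Hoelder_three_cubes:
  fixes F g1 g2 g3 :: "'x \<Rightarrow> real"
  assumes fin: "finite X"
    and nonneg: "\<And>x. x \<in> X \<Longrightarrow> 0 \<le> F x" "\<And>x. x \<in> X \<Longrightarrow> 0 \<le> g1 x"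
      "\<And>x. x \<in> X \<Longrightarrow> 0 \<le> g2 x" "\<And>x. x \<in> X \<Longrightarrow> 0 \<le> g3 x"
    and le: "\<And>x. x \<in> X \<Longrightarrow> F x ^ 3 \<le> g1 x * g2 x * g3 x"
  shows "(\<Sum>x\<in>X. F x) ^ 3 \<le> (\<Sum>x\<in>X. g1 x) * (\<Sum>x\<in>X. g2 x) * (\<Sum>x\<in>X. g3 x)"
proof (cases "X = {}")
  case False
  define n where "n = real (card X)"
  have n: "0 < n" using False fin by (simp add: n_def card_gt_0_iff)
  define g where "g j = (if j = (0::nat) then g1 else if j = 1 then g2 else g3)" for j
  have J: "{..<3::nat} = {0, 1, 2}" by auto
  have g0: "0 \<le> g j x" if "x \<in> X" for j x using nonneg that by (simp add: g_def)
  have cube: "(a powr (1/3) * (b powr (1/3) * c powr (1/3))) ^ 3 = a * b * c"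
    if "0 \<le> a" "0 \<le> b" "0 \<le> c" for a b c :: real
  proof -
    have *: "(a powr (1/3)) ^ 3 = a" if "0 \<le> a" for a :: real
      using that by (cases "a = 0") (simp_all add: powr_power)
    show ?thesis using that by (simp add: power_mult_distrib *)
  qed
  have "F x \<le> (\<Prod>j<3. g j x powr (1/3))" if "x \<in> X" for x
  proof (rule power_le_imp_le_base)
    show "F x ^ Suc 2 \<le> (\<Prod>j<3. g j x powr (1/3)) ^ Suc 2"
      using cube[of "g1 x" "g2 x" "g3 x"] le nonneg that by (simp add: J g_def)
  qed (simp add: prod_nonneg)
  then have "(\<Sum>x\<in>X. F x) / n \<le> (\<Sum>x\<in>X. \<Prod>j<3. g j x powr (1/3)) / n"
    using n by (intro divide_right_mono sum_mono) auto
  also have "\<dots> \<le> (\<Prod>j<3. ((\<Sum>x\<in>X. g j x) / n) powr (1/3))"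
    unfolding n_def using fin g0 by (intro Hoelder_average) auto
  finally have "((\<Sum>x\<in>X. F x) / n) ^ 3 \<le> (\<Prod>j<3. ((\<Sum>x\<in>X. g j x) / n) powr (1/3)) ^ 3"
    using nonneg n by (intro power_mono divide_nonneg_pos sum_nonneg) auto
  also have "\<dots> = ((\<Sum>x\<in>X. g1 x) / n) * ((\<Sum>x\<in>X. g2 x) / n) * ((\<Sum>x\<in>X. g3 x) / n)"
    using cube[of "sum g1 X / n" "sum g2 X / n" "sum g3 X / n"] nonneg n
    by (simp add: J g_def sum_nonneg)
  finally show ?thesis
    using n by (simp add: power_divide field_simps power3_eq_cube)
qed simp

lemma sum_PiE_insert:
  fixes F :: "('v \<Rightarrow> 'x) \<Rightarrow> real"
  assumes "v \<notin> V"
  shows "(\<Sum>\<phi>\<in>insert v V \<rightarrow>\<^sub>E X. F \<phi>) = (\<Sum>\<phi>\<in>V \<rightarrow>\<^sub>E X. \<Sum>x\<in>X. F (\<phi>(v := x)))"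
proof -
  have "(\<Sum>\<phi>\<in>insert v V \<rightarrow>\<^sub>E X. F \<phi>) = (\<Sum>(x, \<phi>)\<in>X \<times> (V \<rightarrow>\<^sub>E X). F (\<phi>(v := x)))"
    unfolding PiE_insert_eq using inj_combinator[OF assms, of "\<lambda>_. X"]
    by (subst sum.reindex) (auto simp: case_prod_unfold comp_def)
  also have "\<dots> = (\<Sum>x\<in>X. \<Sum>\<phi>\<in>V \<rightarrow>\<^sub>E X. F (\<phi>(v := x)))"
    by (simp add: sum.cartesian_product)
  also have "\<dots> = (\<Sum>\<phi>\<in>V \<rightarrow>\<^sub>E X. \<Sum>x\<in>X. F (\<phi>(v := x)))"
    by (rule sum.swap)
  finally show ?thesis .
qed

text \<open>Induction on \<open>V\<close>, averaging out one coordinate \<open>v\<close> at a time.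
  Only the factors with \<open>v \<in> S j\<close> depend on that coordinate, and their weights add
  up to at most 1, so Hoelder applies to them.\<close>

lemma Finner_inequality:
  fixes g :: "'j \<Rightarrow> ('v \<Rightarrow> 'x) \<Rightarrow> real" and w :: "'j \<Rightarrow> real"
  assumes "finite V" and X: "finite X" and J: "finite J"
    and w: "\<And>j. j \<in> J \<Longrightarrow> 0 \<le> w j"
    and "\<And>v. v \<in> V \<Longrightarrow> (\<Sum>j | j \<in> J \<and> v \<in> S j. w j) \<le> 1"
    and "\<And>j. j \<in> J \<Longrightarrow> S j \<subseteq> V"
    and "\<And>j \<psi>. j \<in> J \<Longrightarrow> 0 \<le> g j \<psi>"
  shows "(\<Sum>\<phi>\<in>V \<rightarrow>\<^sub>E X. \<Prod>j\<in>J. g j (restrict \<phi> (S j)) powr w j) / real (card X) ^ card V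
    \<le> (\<Prod>j\<in>J. ((\<Sum>\<psi>\<in>S j \<rightarrow>\<^sub>E X. g j \<psi>) / real (card X) ^ card (S j)) powr w j)"
  using assms(1,5-)
proof (induction V arbitrary: S g)
  case empty
  then have "S j = {}" if "j \<in> J" for j using that by blast
  then show ?case by (simp add: PiE_empty_domain restrict_def)
next
  case (insert v V)
  define n where "n = real (card X)"
  define J1 where "J1 = {j \<in> J. v \<in> S j}"
  have J1: "finite J1" "J1 \<subseteq> J" using J by (auto simp: J1_def)
  \<comment> \<open>The factor after averaging over the value at \<open>v\<close>; it lives on the
    smaller coordinate set \<open>S' j\<close>.\<close>
  define g' where "g' j \<psi> = (if v \<in> S j then (\<Sum>x\<in>X. g j (\<psi>(v := x))) / n else g j \<psi>)" for j \<psi>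
  define S' where "S' j = S j - {v}" for j
  have finS: "finite (S j)" if "j \<in> J" for j
    using insert.prems(2)[OF that] insert.hyps(1) by (auto intro: finite_subset)
  have step: "(\<Sum>x\<in>X. \<Prod>j\<in>J. g j (restrict (\<phi>(v := x)) (S j)) powr w j) / n
      \<le> (\<Prod>j\<in>J. g' j (restrict \<phi> (S' j)) powr w j)" for \<phi>
  proof -
    define Q where "Q = (\<Prod>j\<in>J - J1. g j (restrict \<phi> (S j)) powr w j)"
    have Q0: "0 \<le> Q" by (simp add: Q_def prod_nonneg)
    have split: "(\<Prod>j\<in>J. h j) = (\<Prod>j\<in>J - J1. h j) * (\<Prod>j\<in>J1. h j)" for h :: "'j \<Rightarrow> real"
      using J1 J by (rule_tac prod.subset_diff)
    have r1: "restrict (\<phi>(v := x)) (S j) = (restrict \<phi> (S' j))(v := x)" if "j \<in> J1" for j x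
      using that by (auto simp: J1_def S'_def restrict_def)
    have r2: "restrict (\<phi>(v := x)) (S j) = restrict \<phi> (S j)" "S' j = S j" if "j \<in> J - J1" for j x
      using that by (auto simp: J1_def S'_def restrict_def)
    have "(\<Sum>x\<in>X. \<Prod>j\<in>J. g j (restrict (\<phi>(v := x)) (S j)) powr w j) / n
        = Q * ((\<Sum>x\<in>X. \<Prod>j\<in>J1. g j ((restrict \<phi> (S' j))(v := x)) powr w j) / n)"
      unfolding split by (simp add: Q_def r1 r2 sum_distrib_left)
    also have "\<dots> \<le> Q * (\<Prod>j\<in>J1. ((\<Sum>x\<in>X. g j ((restrict \<phi> (S' j))(v := x))) / n) powr w j)"
      unfolding n_def using J1 X w insert.prems(1)[of v] insert.prems(3) Q0
      by (intro mult_left_mono Hoelder_average) (auto simp: J1_def)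
    also have "\<dots> = (\<Prod>j\<in>J. g' j (restrict \<phi> (S' j)) powr w j)"
      unfolding split Q_def
      by (intro arg_cong2[where f = "(*)"] prod.cong refl) (auto simp: g'_def J1_def S'_def)
    finally show ?thesis .
  qed
  have n0: "0 \<le> n" by (simp add: n_def)
  \<comment> \<open>Averaging over \<open>v\<close> and then over \<open>S' j\<close> is averaging
    over \<open>S j\<close>, so the right-hand side of the induction hypothesis is already the
    desired one.\<close>
  have sums: "(\<Sum>\<psi>\<in>S' j \<rightarrow>\<^sub>E X. g' j \<psi>) / n ^ card (S' j) = (\<Sum>\<psi>\<in>S j \<rightarrow>\<^sub>E X. g j \<psi>) / n ^ card (S j)"
    if "j \<in> J" for j
  proof (cases "v \<in> S j")
    case True
    then have S: "S j = insert v (S' j)" "v \<notin> S' j" by (auto simp: S'_def)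
    have "finite (S' j)" using finS[OF that] by (simp add: S'_def)
    then have "card (S j) = Suc (card (S' j))" using S by simp
    moreover have "(\<Sum>\<psi>\<in>S j \<rightarrow>\<^sub>E X. g j \<psi>) = (\<Sum>\<psi>\<in>S' j \<rightarrow>\<^sub>E X. \<Sum>x\<in>X. g j (\<psi>(v := x)))"
      unfolding S(1) by (rule sum_PiE_insert[OF S(2)])
    ultimately show ?thesis
      using True by (simp add: g'_def sum_divide_distrib[symmetric])
  next
    case False
    then show ?thesis by (simp add: S'_def g'_def)
  qed
  have "(\<Sum>\<phi>\<in>insert v V \<rightarrow>\<^sub>E X. \<Prod>j\<in>J. g j (restrict \<phi> (S j)) powr w j) / n ^ card (insert v V)
      = (\<Sum>\<phi>\<in>V \<rightarrow>\<^sub>E X. (\<Sum>x\<in>X. \<Prod>j\<in>J. g j (restrict (\<phi>(v := x)) (S j)) powr w j) / n) / n ^ card V"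
    unfolding sum_PiE_insert[OF insert.hyps(2)] using insert.hyps
    by (simp add: sum_divide_distrib[symmetric])
  also have "\<dots> \<le> (\<Sum>\<phi>\<in>V \<rightarrow>\<^sub>E X. \<Prod>j\<in>J. g' j (restrict \<phi> (S' j)) powr w j) / n ^ card V"
    using n0 by (intro divide_right_mono sum_mono step) auto
  also have "\<dots> \<le> (\<Prod>j\<in>J. ((\<Sum>\<psi>\<in>S' j \<rightarrow>\<^sub>E X. g' j \<psi>) / n ^ card (S' j)) powr w j)"
    unfolding n_def
  proof (rule insert.IH)
    show "(\<Sum>j | j \<in> J \<and> u \<in> S' j. w j) \<le> 1" if "u \<in> V" for u
    proof -
      have "u \<noteq> v" using that insert.hyps by auto
      then show ?thesis using insert.prems(1)[of u] that by (simp add: S'_def)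
    qed
    show "S' j \<subseteq> V" if "j \<in> J" for j using insert.prems(2)[OF that] by (auto simp: S'_def)
    show "0 \<le> g' j \<psi>" if "j \<in> J" for j \<psi>
      using insert.prems(3)[OF that] n0 by (auto simp: g'_def intro!: divide_nonneg_nonneg sum_nonneg)
  qed
  also have "\<dots> = (\<Prod>j\<in>J. ((\<Sum>\<psi>\<in>S j \<rightarrow>\<^sub>E X. g j \<psi>) / n ^ card (S j)) powr w j)"
    by (intro prod.cong refl) (simp add: sums)
  finally show ?case unfolding n_def .
qed

section \<open>Koenig's theorem\<close>

text \<open>If the common left end is in \<open>X1\<close> or \<open>X2\<close>, that cover already
  covers all of \<open>E\<close>. Otherwise \<open>e\<close> and \<open>f\<close> are covered on the
  right, and two mixtures cover \<open>E\<close>: intersect left and unite right, or unite left, add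
  \<open>fst e\<close> and intersect right. Their sizes add up to one more than those of the given
  covers, hence to at most \<open>2 * t - 1\<close>, so one of them is below
  \<open>t\<close>.\<close>

lemma bipartite_cover_merge:
  fixes E :: "('a \<times> 'b) set"
  assumes fin: "finite X1" "finite X2" "finite Y1" "finite Y2"
    and 1: "E - {e} \<subseteq> X1 \<times> UNIV \<union> UNIV \<times> Y1" "card X1 + card Y1 < t"
    and 2: "E - {f} \<subseteq> X2 \<times> UNIV \<union> UNIV \<times> Y2" "card X2 + card Y2 < t"
    and e: "e \<in> E" and f: "f \<in> E" and ne: "e \<noteq> f" and eq: "fst e = fst f"
  shows "\<exists>X Y. finite X \<and> finite Y \<and> E \<subseteq> X \<times> UNIV \<union> UNIV \<times> Y \<and> card X + card Y < t"
proof -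
  consider "fst e \<in> X1" | "fst e \<in> X2" | "fst e \<notin> X1" "fst e \<notin> X2" by blast
  then show ?thesis
  proof cases
    case 1
    then have "E \<subseteq> X1 \<times> UNIV \<union> UNIV \<times> Y1"
      using assms(5) by (auto simp: mem_Times_iff)
    then show ?thesis using fin assms(6) by blast
  next
    case 2
    then have "E \<subseteq> X2 \<times> UNIV \<union> UNIV \<times> Y2"
      using assms(7) eq by (auto simp: mem_Times_iff)
    then show ?thesis using fin assms(8) by blast
  next
    case 3
    have "e \<in> X2 \<times> UNIV \<union> UNIV \<times> Y2" "f \<in> X1 \<times> UNIV \<union> UNIV \<times> Y1"
      using 1(1) 2(1) e f ne by auto
    then have "snd e \<in> Y2" "snd f \<in> Y1"
      using 3 eq by (auto simp: mem_Times_iff)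
    moreover have "g \<in> X1 \<times> UNIV \<union> UNIV \<times> Y1" "g \<in> X2 \<times> UNIV \<union> UNIV \<times> Y2"
      if "g \<in> E" "g \<noteq> e" "g \<noteq> f" for g
      using 1(1) 2(1) that by auto
    ultimately have covers: "g \<in> (X1 \<inter> X2) \<times> UNIV \<union> UNIV \<times> (Y1 \<union> Y2)"
      "g \<in> insert (fst e) (X1 \<union> X2) \<times> UNIV \<union> UNIV \<times> (Y1 \<inter> Y2)" if "g \<in> E" for g
      using that eq by (cases "g = e"; cases "g = f"; force simp: mem_Times_iff)+
    have "card (X1 \<inter> X2) + card (Y1 \<union> Y2) + (card (insert (fst e) (X1 \<union> X2)) + card (Y1 \<inter> Y2))
        = Suc (card X1 + card Y1 + (card X2 + card Y2))"
      using card_Un_Int[of X1 X2] card_Un_Int[of Y1 Y2] fin 3 by simp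
    with 1(2) 2(2) consider "card (X1 \<inter> X2) + card (Y1 \<union> Y2) < t"
      | "card (insert (fst e) (X1 \<union> X2)) + card (Y1 \<inter> Y2) < t"
      by linarith
    then show ?thesis
    proof cases
      case 1
      show ?thesis
        by (rule exI[of _ "X1 \<inter> X2"], rule exI[of _ "Y1 \<union> Y2"]) (use covers(1) fin 1 in blast)
    next
      case 2
      show ?thesis
        by (rule exI[of _ "insert (fst e) (X1 \<union> X2)"], rule exI[of _ "Y1 \<inter> Y2"])
          (use covers(2) fin 2 in blast)
    qed
  qed
qed

text \<open>
  Lovasz's proof: if no arc can be deleted without lowering the minimum size of a cover,
  then the relation is itself a matching, since small covers that miss only one of two adjacent arcs
  can be merged into a small cover of everything.
\<close>

theorem koenig:
  fixes E :: "('a \<times> 'b) set"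
  assumes "finite E"
  shows "\<exists>M X Y. M \<subseteq> E \<and> inj_on fst M \<and> inj_on snd M \<and> finite X \<and> finite Y \<and>
    E \<subseteq> X \<times> UNIV \<union> UNIV \<times> Y \<and> card X + card Y \<le> card M"
  using assms
proof (induction E rule: finite_psubset_induct)
  case (psubset E)
  define covers where "covers F X Y \<longleftrightarrow> finite X \<and> finite Y \<and> F \<subseteq> X \<times> UNIV \<union> UNIV \<times> Y"
    for F :: "('a \<times> 'b) set" and X Y
  define is_size where "is_size k \<longleftrightarrow> (\<exists>X Y. covers E X Y \<and> card X + card Y = k)" for k
  define t where "t = Least is_size"
  \<comment> \<open>The trivial cover by all left ends shows that \<open>t\<close> exists; when
    \<open>E\<close> itself is a matching, it is also the cover sought.\<close>
  have dom: "covers E (fst ` E) {}"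
    using psubset.hyps by (force simp: covers_def)
  then have "\<exists>k. is_size k" unfolding is_size_def by blast
  then have "is_size t" unfolding t_def by (rule LeastI_ex)
  then obtain X0 Y0 where XY0: "covers E X0 Y0" "card X0 + card Y0 = t"
    unfolding is_size_def by blast
  have minimal: "\<not> (\<exists>X Y. finite X \<and> finite Y \<and> E \<subseteq> X \<times> UNIV \<union> UNIV \<times> Y \<and> card X + card Y < t)"
    using not_less_Least[of _ is_size] unfolding t_def is_size_def covers_def by blast
  show ?case
  proof (cases "\<exists>e\<in>E. \<exists>M\<subseteq>E - {e}. inj_on fst M \<and> inj_on snd M \<and> t \<le> card M")
    case True
    then show ?thesis using XY0 unfolding covers_def by blast
  next
    case False
    \<comment> \<open>The induction hypothesis gives a matching in \<open>E - {e}\<close> that is as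
      large as some cover there; as it has fewer than \<open>t\<close> arcs, so does that
      cover.\<close>
    have crit: "\<exists>X Y. covers (E - {e}) X Y \<and> card X + card Y < t" if "e \<in> E" for e
    proof -
      have "E - {e} \<subset> E" using that by blast
      from psubset.IH[OF this] obtain M X Y where
        M: "M \<subseteq> E - {e}" "inj_on fst M" "inj_on snd M" and
        XY: "covers (E - {e}) X Y" "card X + card Y \<le> card M"
        unfolding covers_def by blast
      with False that have "card M < t" by (meson not_le)
      with XY show ?thesis by (meson order.strict_trans1)
    qed
    have "fst e \<noteq> fst f \<and> snd e \<noteq> snd f" if e: "e \<in> E" and f: "f \<in> E" and ne: "e \<noteq> f" for e f
    proof -
      obtain X1 Y1 where 1: "covers (E - {e}) X1 Y1" "card X1 + card Y1 < t" using crit[OF e] by blast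
      obtain X2 Y2 where 2: "covers (E - {f}) X2 Y2" "card X2 + card Y2 < t" using crit[OF f] by blast
      have fin: "finite X1" "finite X2" "finite Y1" "finite Y2"
        using 1 2 by (auto simp: covers_def)
      have "fst e \<noteq> fst f"
        using bipartite_cover_merge[of X1 X2 Y1 Y2 E e t f] fin 1 2 e f ne minimal
        unfolding covers_def by blast
      moreover have "snd e \<noteq> snd f"
      proof
        assume eq: "snd e = snd f"
        \<comment> \<open>A common right end is a common left end of the reversed relation.\<close>
        have "\<exists>Y X. finite Y \<and> finite X \<and> prod.swap ` E \<subseteq> Y \<times> UNIV \<union> UNIV \<times> X \<and> card Y + card X < t"
        proof (rule bipartite_cover_merge[of Y1 Y2 X1 X2 _ "prod.swap e" t "prod.swap f"])
          show "prod.swap ` E - {prod.swap e} \<subseteq> Y1 \<times> UNIV \<union> UNIV \<times> X1"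
            using 1(1) by (fastforce simp: covers_def)
          show "prod.swap ` E - {prod.swap f} \<subseteq> Y2 \<times> UNIV \<union> UNIV \<times> X2"
            using 2(1) by (fastforce simp: covers_def)
        qed (use fin 1 2 e f ne eq in \<open>auto simp: add.commute prod_eq_iff\<close>)
        then obtain X Y where "finite Y" "finite X" "prod.swap ` E \<subseteq> Y \<times> UNIV \<union> UNIV \<times> X"
          "card X + card Y < t"
          by (metis add.commute)
        moreover from this(3) have "E \<subseteq> X \<times> UNIV \<union> UNIV \<times> Y"
          by (auto simp: image_subset_iff)
        ultimately show False using minimal by blast
      qed
      ultimately show ?thesis by blast
    qed
    then have "inj_on fst E" "inj_on snd E"
      by (auto intro!: inj_onI)
    moreover have "card (fst ` E) + card {} \<le> card E"
      using psubset.hyps by (simp add: card_image_le)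
    ultimately show ?thesis using dom unfolding covers_def by blast
  qed
qed

section \<open>Homomorphism densities and fractional packings\<close>

lemma simple_graphD:
  assumes "simple_graph G"
  shows "finite (pverts G)" "finite (parcs G)" "0 < nverts G" "parcs G \<subseteq> pverts G \<times> pverts G"
    "\<And>x y. (x, y) \<in> parcs G \<Longrightarrow> x \<in> pverts G \<and> y \<in> pverts G \<and> x \<noteq> y \<and> (y, x) \<in> parcs G"
proof -
  interpret pair_graph G using assms by (simp add: simple_graph_def)
  show "finite (pverts G)" "finite (parcs G)" by (rule pair_finite_verts pair_finite_arcs)+
  then show "0 < nverts G" using assms by (simp add: simple_graph_def nverts_def card_gt_0_iff)
  show "parcs G \<subseteq> pverts G \<times> pverts G" using wellformed' by auto
  show "x \<in> pverts G \<and> y \<in> pverts G \<and> x \<noteq> y \<and> (y, x) \<in> parcs G" if "(x, y) \<in> parcs G" for x y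
  proof -
    have "sym (parcs G)" using pair_sym_arcs by (simp add: symmetric_def)
    then show ?thesis using that wellformed' pair_no_loops[OF that] by (auto dest: symD)
  qed
qed

lemma simple_graphI:
  assumes "finite V" "V \<noteq> {}" "E \<subseteq> V \<times> V" "\<And>x y. (x, y) \<in> E \<Longrightarrow> x \<noteq> y \<and> (y, x) \<in> E"
  shows "simple_graph \<lparr>pverts = V, parcs = E\<rparr>"
proof -
  have "finite E" using assms(1,3) by (meson finite_SigmaI finite_subset)
  moreover have "symmetric (with_proj \<lparr>pverts = V, parcs = E\<rparr>)"
    using assms(4) by (auto simp: symmetric_def intro: symI)
  ultimately have "pair_graph \<lparr>pverts = V, parcs = E\<rparr>"
    using assms by unfold_locales auto
  then show ?thesis using assms(2) by (simp add: simple_graph_def)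
qed

lemma is_subgraphD:
  assumes "is_subgraph K H"
  shows "pverts K \<subseteq> pverts H" "parcs K \<subseteq> parcs H" "parcs K \<subseteq> pverts K \<times> pverts K"
proof -
  have s: "subgraph (with_proj K) (with_proj H)" using assms by (simp add: is_subgraph_def)
  then show "pverts K \<subseteq> pverts H" "parcs K \<subseteq> parcs H" by (auto simp: subgraph_def)
  have "wf_digraph (with_proj K)" using s by (simp add: subgraph_def)
  then show "parcs K \<subseteq> pverts K \<times> pverts K"
    using wf_digraph.tail_in_verts[of "with_proj K"] wf_digraph.head_in_verts[of "with_proj K"] by force
qed

text \<open>On both sides \<open>with_proj\<close> has \<open>fst\<close> and \<open>snd\<close> as
  tail and head, so the arc map of an isomorphism is determined by its vertex map.\<close>

lemma isomorphicE:
  assumes "isomorphic G K"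
  obtains f where "bij_betw f (pverts G) (pverts K)" "parcs K = map_prod f f ` parcs G"
    "parcs G \<subseteq> pverts G \<times> pverts G"
proof -
  obtain h where h: "pre_digraph.digraph_isomorphism (with_proj G) h" "with_proj K = app_iso h (with_proj G)"
    using assms by (auto simp: isomorphic_def digraph_iso_def)
  define f where "f = iso_verts h"
  have V: "pverts K = f ` pverts G" and A: "parcs K = iso_arcs h ` parcs G"
    and tl: "fst = iso_tail h" and hd: "snd = iso_head h"
    using arg_cong[OF h(2), of verts] arg_cong[OF h(2), of arcs]
      arg_cong[OF h(2), of tail] arg_cong[OF h(2), of head] by (simp_all add: f_def)
  have "iso_arcs h a = map_prod f f a" if "a \<in> parcs G" for a
    using h(1) that tl hd by (auto simp: pre_digraph.digraph_isomorphism_def f_def prod_eq_iff)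
  then have "parcs K = map_prod f f ` parcs G"
    using A by simp
  moreover have "bij_betw f (pverts G) (pverts K)"
    using h(1) V by (simp add: pre_digraph.digraph_isomorphism_def bij_betw_def f_def)
  moreover have "wf_digraph (with_proj G)"
    using h(1) by (simp add: pre_digraph.digraph_isomorphism_def)
  then have "parcs G \<subseteq> pverts G \<times> pverts G"
    using wf_digraph.tail_in_verts[of "with_proj G"] wf_digraph.head_in_verts[of "with_proj G"] by force
  ultimately show ?thesis using that by blast
qed

lemma isomorphic_nverts: "isomorphic G K \<Longrightarrow> nverts G = nverts K"
  by (erule isomorphicE) (simp add: nverts_def bij_betw_same_card)

section \<open>Homomorphisms and their densities\<close>

definition homs :: "'a pair_pre_digraph \<Rightarrow> 'b pair_pre_digraph \<Rightarrow> ('a \<Rightarrow> 'b) set" where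
  "homs H T = {\<phi> \<in> pverts H \<rightarrow>\<^sub>E pverts T. \<forall>(x, y) \<in> parcs H. (\<phi> x, \<phi> y) \<in> parcs T}"

lemma hom_count_homs: "hom_count H T = card (homs H T)"
  by (simp add: hom_count_def homs_def)

lemma homsD:
  assumes "\<phi> \<in> homs H T"
  shows "\<phi> \<in> pverts H \<rightarrow>\<^sub>E pverts T" "(x, y) \<in> parcs H \<Longrightarrow> (\<phi> x, \<phi> y) \<in> parcs T"
  using assms by (auto simp: homs_def)

lemma isomorphic_hom_count:
  assumes "isomorphic G K"
  shows "hom_count G T = hom_count K T"
proof -
  obtain f where f: "bij_betw f (pverts G) (pverts K)" and K: "parcs K = map_prod f f ` parcs G"
    and G: "parcs G \<subseteq> pverts G \<times> pverts G"
    using assms by (rule isomorphicE)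
  define g where "g = the_inv_into (pverts G) f"
  have fK: "f x \<in> pverts K" and gf: "g (f x) = x" if "x \<in> pverts G" for x
    using that f by (auto simp: g_def bij_betw_imp_inj_on the_inv_into_f_f dest: bij_betwE)
  have gG: "g y \<in> pverts G" and fg: "f (g y) = y" if "y \<in> pverts K" for y
    using that bij_betwE[OF bij_betw_the_inv_into[OF f]] f_the_inv_into_f_bij_betw[OF f]
    by (auto simp: g_def)
  have "bij_betw (\<lambda>\<phi>. restrict (\<phi> \<circ> f) (pverts G)) (homs K T) (homs G T)"
  proof (rule bij_betw_byWitness[where f' = "\<lambda>\<psi>. restrict (\<psi> \<circ> g) (pverts K)"])
    show "\<forall>\<phi>\<in>homs K T. restrict (restrict (\<phi> \<circ> f) (pverts G) \<circ> g) (pverts K) = \<phi>"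
      by (auto simp: homs_def gG fg PiE_iff intro!: extensionalityI[of _ "pverts K"])
    show "\<forall>\<psi>\<in>homs G T. restrict (restrict (\<psi> \<circ> g) (pverts K) \<circ> f) (pverts G) = \<psi>"
      by (auto simp: homs_def fK gf PiE_iff intro!: extensionalityI[of _ "pverts G"])
    show "(\<lambda>\<phi>. restrict (\<phi> \<circ> f) (pverts G)) ` homs K T \<subseteq> homs G T"
      using G fK by (fastforce simp: homs_def K PiE_iff)
    show "(\<lambda>\<psi>. restrict (\<psi> \<circ> g) (pverts K)) ` homs G T \<subseteq> homs K T"
    proof (rule image_subsetI)
      fix \<psi> assume \<psi>: "\<psi> \<in> homs G T"
      have "(\<psi> (g (f x)), \<psi> (g (f y))) \<in> parcs T \<and> f x \<in> pverts K \<and> f y \<in> pverts K" if "(x, y) \<in> parcs G" for x y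
        using that \<psi> G fK by (auto simp: homs_def gf dest!: subsetD)
      then show "restrict (\<psi> \<circ> g) (pverts K) \<in> homs K T"
        using \<psi> gG by (auto simp: homs_def K)
    qed
  qed
  then show ?thesis
    by (simp add: hom_count_homs bij_betw_same_card)
qed

lemma isomorphic_hom_density: "isomorphic G K \<Longrightarrow> hom_density G T = hom_density K T"
  by (simp add: hom_density_def isomorphic_hom_count isomorphic_nverts)

lemma finite_homs:
  assumes "finite (pverts H)" "finite (pverts T)"
  shows "finite (homs H T)"
  using assms by (auto simp: homs_def intro: finite_subset[OF _ finite_PiE[of "pverts H" "\<lambda>_. pverts T"]])

lemma hom_density_nonneg: "0 \<le> hom_density H T"
  by (simp add: hom_density_def)

lemma hom_density_le_1:
  assumes "finite (pverts H)" "simple_graph T"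
  shows "hom_density H T \<le> 1"
proof -
  note T = simple_graphD[OF assms(2)]
  have "card (homs H T) \<le> card (pverts H \<rightarrow>\<^sub>E pverts T)"
    using assms T by (intro card_mono finite_PiE) (auto simp: homs_def)
  also have "\<dots> = nverts T ^ nverts H"
    using assms by (simp add: card_funcsetE nverts_def)
  finally show ?thesis
    using T(3) by (simp add: hom_density_def hom_count_homs divide_le_eq flip: of_nat_power)
qed

text \<open>Finner's inequality with \<open>g j\<close> the indicator of the homomorphisms from
  \<open>K j\<close>: a homomorphism from \<open>H\<close> restricts to one from every
  \<open>K j\<close>.\<close>

lemma hom_density_le_fractional_packing:
  fixes K :: "'j \<Rightarrow> 'a pair_pre_digraph"
  assumes H: "finite (pverts H)" and T: "simple_graph T" and J: "finite J"
    and K: "\<And>j. j \<in> J \<Longrightarrow> is_subgraph (K j) H"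
    and w: "\<And>j. j \<in> J \<Longrightarrow> 0 \<le> w j"
    and packing: "\<And>v. v \<in> pverts H \<Longrightarrow> (\<Sum>j | j \<in> J \<and> v \<in> pverts (K j). w j) \<le> 1"
  shows "hom_density H T \<le> (\<Prod>j\<in>J. hom_density (K j) T powr w j)"
proof -
  define g where "g j \<psi> = (if \<psi> \<in> homs (K j) T then 1 else 0 :: real)" for j \<psi>
  note T' = simple_graphD[OF T]
  have finP: "finite (S \<rightarrow>\<^sub>E pverts T)" if "S \<subseteq> pverts H" for S
    using that H T' by (intro finite_PiE) (auto intro: finite_subset)
  \<comment> \<open>At a homomorphism every factor is \<open>1 powr w j = 1\<close>, also when
    \<open>w j = 0\<close>.\<close>
  have "(\<Sum>\<phi>\<in>homs H T. 1) \<le> (\<Sum>\<phi>\<in>homs H T. \<Prod>j\<in>J. g j (restrict \<phi> (pverts (K j))) powr w j)"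
  proof (rule sum_mono)
    fix \<phi> assume \<phi>: "\<phi> \<in> homs H T"
    have "restrict \<phi> (pverts (K j)) \<in> homs (K j) T" if "j \<in> J" for j
      using \<phi> is_subgraphD[OF K[OF that]] by (fastforce simp: homs_def PiE_iff)
    then show "(1 :: real) \<le> (\<Prod>j\<in>J. g j (restrict \<phi> (pverts (K j))) powr w j)"
      by (simp add: g_def)
  qed
  also have "\<dots> \<le> (\<Sum>\<phi>\<in>pverts H \<rightarrow>\<^sub>E pverts T. \<Prod>j\<in>J. g j (restrict \<phi> (pverts (K j))) powr w j)"
    using finP[of "pverts H"] by (intro sum_mono2) (auto simp: homs_def prod_nonneg)
  finally have "hom_density H T \<le> (\<Sum>\<phi>\<in>pverts H \<rightarrow>\<^sub>E pverts T. \<Prod>j\<in>J. g j (restrict \<phi> (pverts (K j))) powr w j)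
      / real (card (pverts T)) ^ card (pverts H)"
    unfolding hom_density_def nverts_def hom_count_homs by (intro divide_right_mono) auto
  also have "\<dots> \<le> (\<Prod>j\<in>J. ((\<Sum>\<psi>\<in>pverts (K j) \<rightarrow>\<^sub>E pverts T. g j \<psi>)
      / real (card (pverts T)) ^ card (pverts (K j))) powr w j)"
    using H T' J w packing is_subgraphD(1)[OF K]
    by (intro Finner_inequality) (auto simp: g_def)
  also have "\<dots> = (\<Prod>j\<in>J. hom_density (K j) T powr w j)"
  proof (rule prod.cong[OF refl])
    fix j assume "j \<in> J"
    then have fin: "finite (pverts (K j) \<rightarrow>\<^sub>E pverts T)" using finP is_subgraphD(1)[OF K] by blast
    have "(\<Sum>\<psi>\<in>pverts (K j) \<rightarrow>\<^sub>E pverts T. g j \<psi>) = (\<Sum>\<psi>\<in>homs (K j) T. 1)"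
      unfolding g_def using fin by (intro sum.mono_neutral_cong_right) (auto simp: homs_def)
    then show "((\<Sum>\<psi>\<in>pverts (K j) \<rightarrow>\<^sub>E pverts T. g j \<psi>)
        / real (card (pverts T)) ^ card (pverts (K j))) powr w j = hom_density (K j) T powr w j"
      by (simp add: hom_density_def nverts_def hom_count_homs)
  qed
  finally show ?thesis .
qed

section \<open>Upper and lower bounds for exponents from density estimates\<close>

lemma mem_domination_exponentsI:
  assumes "0 < a" "\<And>T :: nat pair_pre_digraph. simple_graph T \<Longrightarrow> hom_density H T \<le> hom_density G T powr a"
  shows "inverse a \<in> domination_exponents G H"
  unfolding domination_exponents_def
proof safe
  fix T :: "nat pair_pre_digraph" assume T: "simple_graph T"
  have "hom_density H T powr inverse a \<le> (hom_density G T powr a) powr inverse a"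
    using assms T by (intro powr_mono2) (auto simp: hom_density_nonneg)
  also have "\<dots> = hom_density G T"
    using assms(1) hom_density_nonneg[of G T] by (simp add: powr_powr)
  finally show "hom_density H T powr inverse a \<le> hom_density G T" .
qed

text \<open>If \<open>c * b < a\<close>, the two density estimates bound a fixed positive power of
  \<open>m\<close> by a constant, which fails for large \<open>m\<close>.\<close>

lemma domination_exponent_lower_bound:
  fixes T :: "nat \<Rightarrow> nat pair_pre_digraph"
  assumes c: "c \<in> domination_exponents G H" and H: "finite (pverts H)"
    and T: "\<And>m. 0 < m \<Longrightarrow> simple_graph (T m)"
    and G: "\<And>m. 0 < m \<Longrightarrow> hom_density G (T m) \<le> C * real m powr - a"
    and H_ge: "\<And>m. 0 < m \<Longrightarrow> D * real m powr - b \<le> hom_density H (T m)"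
    and pos: "0 < C" "0 < D" "0 < a"
  shows "a \<le> c * b"
proof (rule ccontr)
  assume "\<not> a \<le> c * b"
  have ineq: "hom_density H (T m) powr c \<le> C * real m powr - a" if "0 < m" for m
    using c T[OF that] G[OF that] by (fastforce simp: domination_exponents_def)
  have Hpos: "0 < hom_density H (T m)" if "0 < m" for m
    by (rule less_le_trans[OF _ H_ge[OF that]]) (use pos that in simp)
  \<comment> \<open>For \<open>c \<ge> 0\<close> the lower bound on the density of \<open>H\<close>
    is raised to the power \<open>c\<close>. For \<open>c < 0\<close> this would reverse it; there
    the density being at most 1 makes its power at least 1, so \<open>s = 0\<close> works.\<close>
  have "\<exists>s E. 0 < E \<and> s < a \<and> (\<forall>m>0. E * real m powr - s \<le> C * real m powr - a)"
  proof (cases "0 \<le> c")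
    case True
    have "D powr c * real m powr - (c * b) \<le> C * real m powr - a" if "0 < m" for m
    proof -
      have "D powr c * real m powr - (c * b) = (D * real m powr - b) powr c"
        using pos that by (simp add: powr_mult powr_powr mult.commute)
      also have "\<dots> \<le> hom_density H (T m) powr c"
        using H_ge[OF that] pos that True by (intro powr_mono2) auto
      finally show ?thesis using ineq[OF that] by simp
    qed
    then show ?thesis
      using \<open>\<not> a \<le> c * b\<close> pos by (intro exI[of _ "c * b"] exI[of _ "D powr c"]) auto
  next
    case False
    have "1 \<le> hom_density H (T m) powr c" if "0 < m" for m
      using False Hpos[OF that] hom_density_le_1[OF H T[OF that]]
        powr_mono2'[of c "hom_density H (T m)" 1] by simp
    then show ?thesis
      using pos order_trans[OF _ ineq, of 1] by (intro exI[of _ 0] exI[of _ 1]) simp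
  qed
  then obtain s E where E: "0 < E" and s: "s < a"
    and le: "\<And>m. 0 < m \<Longrightarrow> E * real m powr - s \<le> C * real m powr - a" by blast
  have bound: "real m \<le> (C / E) powr (1 / (a - s))" if "0 < m" for m
  proof -
    have "E * real m powr (a - s) = E * real m powr - s * real m powr a"
      by (simp add: powr_add[symmetric] mult.assoc)
    also have "\<dots> \<le> C * real m powr - a * real m powr a"
      using le[OF that] by (intro mult_right_mono) auto
    also have "\<dots> = C"
      using that by (simp add: powr_add[symmetric] mult.assoc)
    finally have "real m powr (a - s) \<le> C / E"
      using E by (simp add: field_simps)
    then have "(real m powr (a - s)) powr (1 / (a - s)) \<le> (C / E) powr (1 / (a - s))"
      using s by (intro powr_mono2) auto
    then show ?thesis using s that by (simp add: powr_powr)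
  qed
  obtain m where "(C / E) powr (1 / (a - s)) < real m" using reals_Archimedean2 by blast
  moreover have "0 \<le> (C / E) powr (1 / (a - s))" by simp
  ultimately have "0 < m" by (metis of_nat_0_less_iff order.strict_trans1)
  with bound[of m] \<open>(C / E) powr (1 / (a - s)) < real m\<close> show False by simp
qed

section \<open>Walks\<close>

text \<open>The entry at \<open>y\<close> of the all-ones row vector times the \<open>l\<close>-th
  power of the matrix \<open>A\<close>: the weight of all walks with \<open>l\<close> steps that end
  in \<open>y\<close>.\<close>

primrec walk_weight :: "'x set \<Rightarrow> ('x \<Rightarrow> 'x \<Rightarrow> real) \<Rightarrow> nat \<Rightarrow> 'x \<Rightarrow> real" where
  "walk_weight X A 0 y = 1"
| "walk_weight X A (Suc l) y = (\<Sum>x\<in>X. walk_weight X A l x * A x y)"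

text \<open>The arbitrary weight \<open>h\<close> at the last vertex carries the induction: summing
  out that vertex turns its arc into a new weight at the vertex before it.\<close>

lemma sum_walks:
  "(\<Sum>\<phi>\<in>{0..l} \<rightarrow>\<^sub>E X. (\<Prod>i<l. A (\<phi> i) (\<phi> (Suc i))) * h (\<phi> l)) = (\<Sum>x\<in>X. walk_weight X A l x * h x)"
proof (induction l arbitrary: h)
  case 0
  have "(\<Sum>\<phi>\<in>insert 0 {} \<rightarrow>\<^sub>E X. h (\<phi> (0::nat))) = (\<Sum>x\<in>X. h x)"
    by (subst sum_PiE_insert) (auto simp: PiE_empty_domain)
  then show ?case by simp
next
  case (Suc l)
  have "(\<Sum>\<phi>\<in>{0..Suc l} \<rightarrow>\<^sub>E X. (\<Prod>i<Suc l. A (\<phi> i) (\<phi> (Suc i))) * h (\<phi> (Suc l)))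
      = (\<Sum>\<phi>\<in>{0..l} \<rightarrow>\<^sub>E X. \<Sum>x\<in>X. (\<Prod>i<l. A (\<phi> i) (\<phi> (Suc i))) * A (\<phi> l) x * h x)"
    unfolding atLeast0_atMost_Suc by (subst sum_PiE_insert) auto
  also have "\<dots> = (\<Sum>\<phi>\<in>{0..l} \<rightarrow>\<^sub>E X. (\<Prod>i<l. A (\<phi> i) (\<phi> (Suc i))) * (\<Sum>x\<in>X. A (\<phi> l) x * h x))"
    by (simp add: sum_distrib_left mult.assoc)
  also have "\<dots> = (\<Sum>y\<in>X. walk_weight X A l y * (\<Sum>x\<in>X. A y x * h x))"
    by (rule Suc.IH)
  also have "\<dots> = (\<Sum>x\<in>X. walk_weight X A (Suc l) x * h x)"
    by (simp add: sum_distrib_left sum_distrib_right mult.assoc) (rule sum.swap)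
  finally show ?case .
qed

text \<open>
  Let \<open>d\<close> be the degree function, so that walks of length 2 are counted by \<open>\<Sum>x. (d x)\<^sup>2\<close>. For length 3, the summand
  \<open>d y * A y x * d x\<close> is the geometric mean of \<open>(d x)\<^sup>2 * (d y)\<^sup>2\<close>, \<open>A y x * d y\<close> and \<open>A y x * d x\<close>; for length 4,
  \<open>d y * A y z * A z x * d x\<close> is that of \<open>(d x * d z * d y)\<^sup>2\<close>, \<open>A y z * A z x * d y / d z\<close> and
  \<open>A y z * A z x * d x / d z\<close>. Summing the last two factors gives the number of walks of length 2 each time.
  Longer walks split off a walk of length 2.
\<close>

lemma sum_walk_weight_cube_le:
  fixes A :: "'x \<Rightarrow> 'x \<Rightarrow> real"
  assumes X: "finite X" and A01: "\<And>x y. A x y = 0 \<or> A x y = 1" and sym: "\<And>x y. A x y = A y x"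
  shows "(\<Sum>x\<in>X. walk_weight X A (l + 2) x) ^ 3 \<le> (\<Sum>x\<in>X. walk_weight X A 2 x) ^ (l + 3)"
proof -
  define W where "W l = (\<Sum>x\<in>X. walk_weight X A l x)" for l
  define d where "d x = (\<Sum>y\<in>X. A x y)" for x
  have A0: "0 \<le> A x y" and A1: "A x y \<le> 1" for x y using A01[of x y] by auto
  have d0: "0 \<le> d x" for x by (simp add: d_def sum_nonneg A0)
  have w0: "0 \<le> walk_weight X A l x" for l x
    by (induction l arbitrary: x) (auto intro!: sum_nonneg mult_nonneg_nonneg A0)
  have W0: "0 \<le> W l" for l by (simp add: W_def sum_nonneg w0)
  have d': "(\<Sum>y\<in>X. A y x) = d x" for x by (simp add: d_def sym[of _ x])
  have WSuc: "W (Suc l) = (\<Sum>x\<in>X. walk_weight X A l x * d x)" for l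
    unfolding W_def walk_weight.simps by (subst sum.swap) (simp add: d_def sum_distrib_left)
  have w1: "walk_weight X A (Suc 0) x = d x" for x by (simp add: d')
  have W2: "W 2 = (\<Sum>x\<in>X. d x ^ 2)"
    using WSuc[of 1] by (simp add: d' numeral_2_eq_2)
  have Ad: "(\<Sum>x\<in>X. \<Sum>z\<in>X. A z x * d x) = W 2" "(\<Sum>z\<in>X. \<Sum>x\<in>X. A z x * d z) = W 2"
    unfolding W2 by (simp_all add: sum_distrib_right[symmetric] d' d_def[symmetric] power2_eq_square)
  \<comment> \<open>By \<open>A \<le> 1\<close> the arc after the first \<open>l\<close> steps may
    be dropped, which separates them from the last two.\<close>
  have step: "W (l + 3) \<le> W l * W 2" for l
  proof -
    have "W (l + 3) = (\<Sum>x\<in>X. (\<Sum>z\<in>X. walk_weight X A (Suc l) z * A z x) * d x)"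
      using WSuc[of "l + 2"] by (simp add: numeral_3_eq_3 numeral_2_eq_2)
    also have "\<dots> \<le> (\<Sum>x\<in>X. (\<Sum>z\<in>X. W l * A z x) * d x)"
    proof (intro sum_mono mult_right_mono A0 d0)
      show "walk_weight X A (Suc l) z \<le> W l" for z
        unfolding W_def walk_weight.simps using A1 w0 by (intro sum_mono mult_left_le) auto
    qed
    also have "\<dots> = W l * (\<Sum>x\<in>X. \<Sum>z\<in>X. A z x * d x)"
      by (simp add: sum_distrib_left sum_distrib_right mult.assoc)
    finally show ?thesis unfolding Ad .
  qed
  have three: "W 3 ^ 3 \<le> W 2 ^ 4"
  proof -
    have "W 3 = (\<Sum>x\<in>X. \<Sum>y\<in>X. d y * A y x * d x)"
      using WSuc[of 2] by (simp add: numeral_3_eq_3 numeral_2_eq_2 sum_distrib_right d')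
    also have "\<dots> = (\<Sum>(x, y)\<in>X \<times> X. d y * A y x * d x)"
      by (rule sum.cartesian_product)
    also have "\<dots> ^ 3 \<le> (\<Sum>(x, y)\<in>X \<times> X. d x ^ 2 * d y ^ 2) * (\<Sum>(x, y)\<in>X \<times> X. A y x * d y)
        * (\<Sum>(x, y)\<in>X \<times> X. A y x * d x)"
    proof (rule Hoelder_three_cubes)
      fix p assume "p \<in> X \<times> X"
      obtain x y where p: "p = (x, y)" by (cases p)
      show "(case p of (x, y) \<Rightarrow> d y * A y x * d x) ^ 3 \<le> (case p of (x, y) \<Rightarrow> d x ^ 2 * d y ^ 2)
        * (case p of (x, y) \<Rightarrow> A y x * d y) * (case p of (x, y) \<Rightarrow> A y x * d x)"
        using A01[of y x] by (auto simp: p power2_eq_square power3_eq_cube)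
    qed (use X in \<open>auto simp: A0 d0\<close>)
    also have "(\<Sum>(x, y)\<in>X \<times> X. d x ^ 2 * d y ^ 2) = W 2 * W 2"
      by (simp add: W2 sum_product sum.cartesian_product)
    also have "(\<Sum>(x, y)\<in>X \<times> X. A y x * d y) = W 2"
      unfolding sum.cartesian_product[symmetric] by (subst sum.swap) (rule Ad(2))
    also have "(\<Sum>(x, y)\<in>X \<times> X. A y x * d x) = W 2"
      unfolding sum.cartesian_product[symmetric] by (rule Ad(1))
    finally show ?thesis by (simp add: power4_eq_xxxx)
  qed
  have four: "W 4 ^ 3 \<le> W 2 ^ 5"
  proof -
    have triple: "(\<Sum>p\<in>X \<times> X \<times> X. case p of (x, z, y) \<Rightarrow> h x z y) = (\<Sum>x\<in>X. \<Sum>z\<in>X. \<Sum>y\<in>X. h x z y)"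
      for h :: "'x \<Rightarrow> 'x \<Rightarrow> 'x \<Rightarrow> real"
      by (simp add: sum.cartesian_product split_def)
    \<comment> \<open>If \<open>d z = 0\<close>, the quotient is 0 by the convention for division,
      but then no arc meets \<open>z\<close> and \<open>A y z\<close> is 0 as well.\<close>
    have dd: "A y z * (d z / d z) = A y z" "A z y * (d z / d z) = A z y" if "y \<in> X" for y z
    proof -
      show "A y z * (d z / d z) = A y z"
      proof (cases "d z = 0")
        case True
        then have "A z y = 0" using that X A0 by (simp add: d_def sum_nonneg_eq_0_iff)
        then show ?thesis by (simp add: sym)
      qed simp
      then show "A z y * (d z / d z) = A z y" by (simp add: sym)
    qed
    \<comment> \<open>Summing over the end that occurs only in an arc yields \<open>d z\<close>,
      which cancels the denominator.\<close>
    have inner: "(\<Sum>x\<in>X. A y z * A z x * d y / d z) = A y z * (d z / d z) * d y"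
      "(\<Sum>y\<in>X. A y z * A z x * d x / d z) = A z x * (d z / d z) * d x" for x y z
    proof -
      have "(\<Sum>x\<in>X. A y z * A z x * d y / d z) = (\<Sum>x\<in>X. (A y z * d y / d z) * A z x)"
        by (simp add: mult_ac)
      also have "\<dots> = A y z * d y / d z * d z"
        by (simp only: sum_distrib_left[symmetric] d_def[of z])
      finally show "(\<Sum>x\<in>X. A y z * A z x * d y / d z) = A y z * (d z / d z) * d y" by simp
      have "(\<Sum>y\<in>X. A y z * A z x * d x / d z) = (\<Sum>y\<in>X. (A z x * d x / d z) * A y z)"
        by (simp add: mult_ac)
      also have "\<dots> = A z x * d x / d z * d z"
        by (simp only: sum_distrib_left[symmetric] d')
      finally show "(\<Sum>y\<in>X. A y z * A z x * d x / d z) = A z x * (d z / d z) * d x" by simp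
    qed
    have "W 4 = (\<Sum>x\<in>X. \<Sum>z\<in>X. \<Sum>y\<in>X. d y * A y z * A z x * d x)"
      using WSuc[of 3] by (simp add: numeral_eq_Suc sum_distrib_right d' mult.assoc)
    also have "\<dots> = (\<Sum>p\<in>X \<times> X \<times> X. case p of (x, z, y) \<Rightarrow> d y * A y z * A z x * d x)"
      unfolding triple ..
    also have "\<dots> ^ 3 \<le> (\<Sum>p\<in>X \<times> X \<times> X. case p of (x, z, y) \<Rightarrow> d x ^ 2 * d z ^ 2 * d y ^ 2)
        * (\<Sum>p\<in>X \<times> X \<times> X. case p of (x, z, y) \<Rightarrow> A y z * A z x * d y / d z)
        * (\<Sum>p\<in>X \<times> X \<times> X. case p of (x, z, y) \<Rightarrow> A y z * A z x * d x / d z)"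
    proof (rule Hoelder_three_cubes)
      fix p assume "p \<in> X \<times> X \<times> X"
      then obtain x y z where p: "p = (x, z, y)" "y \<in> X" by auto
      show "(case p of (x, z, y) \<Rightarrow> d y * A y z * A z x * d x) ^ 3
        \<le> (case p of (x, z, y) \<Rightarrow> d x ^ 2 * d z ^ 2 * d y ^ 2)
          * (case p of (x, z, y) \<Rightarrow> A y z * A z x * d y / d z)
          * (case p of (x, z, y) \<Rightarrow> A y z * A z x * d x / d z)"
        using A01[of y z] A01[of z x] dd(1)[OF p(2), of z]
        by (cases "d z = 0") (auto simp: p power2_eq_square power3_eq_cube)
    qed (use X in \<open>auto simp: A0 d0\<close>)
    also have "(\<Sum>p\<in>X \<times> X \<times> X. case p of (x, z, y) \<Rightarrow> d x ^ 2 * d z ^ 2 * d y ^ 2) = W 2 * W 2 * W 2"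
      unfolding triple by (simp add: W2 sum_distrib_left sum_distrib_right mult_ac)
    also have "(\<Sum>p\<in>X \<times> X \<times> X. case p of (x, z, y) \<Rightarrow> A y z * A z x * d y / d z) = W 2"
    proof -
      have "(\<Sum>x\<in>X. \<Sum>z\<in>X. \<Sum>y\<in>X. A y z * A z x * d y / d z)
          = (\<Sum>z\<in>X. \<Sum>x\<in>X. \<Sum>y\<in>X. A y z * A z x * d y / d z)"
        by (rule sum.swap)
      also have "\<dots> = (\<Sum>z\<in>X. \<Sum>y\<in>X. \<Sum>x\<in>X. A y z * A z x * d y / d z)"
        by (intro sum.cong refl sum.swap)
      also have "\<dots> = (\<Sum>z\<in>X. \<Sum>y\<in>X. A y z * (d z / d z) * d y)"
        unfolding inner ..
      also have "\<dots> = (\<Sum>z\<in>X. \<Sum>y\<in>X. A z y * d y)"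
        by (intro sum.cong refl) (simp only: dd, simp add: sym)
      also have "\<dots> = (\<Sum>y\<in>X. \<Sum>z\<in>X. A z y * d y)"
        by (rule sum.swap)
      finally show ?thesis unfolding triple Ad .
    qed
    also have "(\<Sum>p\<in>X \<times> X \<times> X. case p of (x, z, y) \<Rightarrow> A y z * A z x * d x / d z) = W 2"
    proof -
      have "(\<Sum>x\<in>X. \<Sum>z\<in>X. \<Sum>y\<in>X. A y z * A z x * d x / d z)
          = (\<Sum>x\<in>X. \<Sum>z\<in>X. A z x * (d z / d z) * d x)"
        unfolding inner ..
      also have "\<dots> = (\<Sum>x\<in>X. \<Sum>z\<in>X. A z x * d x)"
        by (intro sum.cong refl) (simp only: dd)
      finally show ?thesis unfolding triple Ad .
    qed
    finally show ?thesis by (simp add: numeral_eq_Suc mult.assoc)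
  qed
  have "W (l + 2) ^ 3 \<le> W 2 ^ (l + 3)"
  proof (induction l rule: less_induct)
    case (less l)
    \<comment> \<open>The base cases are walks of length 2, 3 and 4; \<open>step\<close> lengthens
      by 3, and both sides gain the factor \<open>W 2 ^ 3\<close>.\<close>
    consider "l = 0" | "l = 1" | "l = 2" | k where "l = k + 3"
      using le_add_diff_inverse2[of 3 l] by (metis (no_types) One_nat_def less_Suc_eq less_one not_le numeral_2_eq_2 numeral_3_eq_3)
    then show ?case
    proof cases
      case 4
      have "W (l + 2) ^ 3 \<le> (W (k + 2) * W 2) ^ 3"
        using step[of "k + 2"] W0 by (intro power_mono) (auto simp: 4 add_ac)
      also have "\<dots> = W (k + 2) ^ 3 * W 2 ^ 3" by (rule power_mult_distrib)
      also have "\<dots> \<le> W 2 ^ (k + 3) * W 2 ^ 3"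
        using less[of k] W0 by (intro mult_right_mono) (auto simp: 4)
      finally show ?thesis by (simp add: 4 power_add[symmetric] add_ac)
    qed (use three four in \<open>auto simp: numeral_eq_Suc\<close>)
  qed
  then show ?thesis by (simp add: W_def)
qed

section \<open>Densities of paths as walk counts\<close>

lemma simple_graph_path_graph: "simple_graph (path_graph l)"
  unfolding path_graph_def by (rule simple_graphI) auto

lemma nverts_path_graph: "nverts (path_graph l) = l + 1"
  by (simp add: nverts_def path_graph_def)

lemma real_hom_count_path:
  assumes T: "simple_graph T"
  shows "real (hom_count (path_graph l) T)
    = (\<Sum>x\<in>pverts T. walk_weight (pverts T) (\<lambda>x y. of_bool ((x, y) \<in> parcs T)) l x)"
proof -
  note T' = simple_graphD[OF T]
  define P where "P = {0..l} \<rightarrow>\<^sub>E pverts T"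
  have finP: "finite P" using T' by (simp add: P_def finite_PiE)
  \<comment> \<open>As the arcs of \<open>T\<close> are symmetric, it suffices to check the forward
    arcs of the path.\<close>
  have "homs (path_graph l) T = {\<phi> \<in> P. \<forall>i<l. (\<phi> i, \<phi> (Suc i)) \<in> parcs T}"
    using T'(5) by (fastforce simp: homs_def path_graph_def P_def)
  then have "real (hom_count (path_graph l) T) = (\<Sum>\<phi>\<in>P. of_bool (\<forall>i<l. (\<phi> i, \<phi> (Suc i)) \<in> parcs T))"
    using finP by (simp add: hom_count_homs Int_def)
  also have "\<dots> = (\<Sum>\<phi>\<in>P. (\<Prod>i<l. of_bool ((\<phi> i, \<phi> (Suc i)) \<in> parcs T)) * 1)"
    by (intro sum.cong refl) (auto simp: of_bool_def intro: prod.neutral prod_zero)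
  also have "\<dots> = (\<Sum>x\<in>pverts T. walk_weight (pverts T) (\<lambda>x y. of_bool ((x, y) \<in> parcs T)) l x * 1)"
    unfolding P_def by (rule sum_walks)
  finally show ?thesis by simp
qed

text \<open>Three paths with \<open>l\<close> edges and \<open>l + 1\<close> paths with two edges
  both have \<open>3 * (l + 1)\<close> vertices, so the inequality between walk counts passes to
  densities.\<close>

lemma hom_density_path_cube_le:
  assumes T: "simple_graph T" and l: "2 \<le> l"
  shows "hom_density (path_graph l) T ^ 3 \<le> hom_density (path_graph 2) T ^ (l + 1)"
proof -
  note T' = simple_graphD[OF T]
  have "real (hom_count (path_graph (l - 2 + 2)) T) ^ 3 \<le> real (hom_count (path_graph 2) T) ^ (l - 2 + 3)"
    unfolding real_hom_count_path[OF T] using T' by (intro sum_walk_weight_cube_le) auto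
  moreover have "l - 2 + 2 = l" "l - 2 + 3 = l + 1" using l by auto
  ultimately have "real (hom_count (path_graph l) T) ^ 3 \<le> real (hom_count (path_graph 2) T) ^ (l + 1)"
    by metis
  then have "real (hom_count (path_graph l) T) ^ 3 / real (nverts T) ^ (3 * (l + 1))
      \<le> real (hom_count (path_graph 2) T) ^ (l + 1) / real (nverts T) ^ (3 * (l + 1))"
    by (intro divide_right_mono) auto
  then show ?thesis
    unfolding hom_density_def nverts_path_graph power_divide power_mult[symmetric] by (simp add: mult.commute)
qed

section \<open>Fractional matchings\<close>

lemma is_subgraphI:
  assumes "pverts K \<subseteq> pverts H" "parcs K \<subseteq> parcs H" "parcs K \<subseteq> pverts K \<times> pverts K"
    "parcs H \<subseteq> pverts H \<times> pverts H"
  shows "is_subgraph K H"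
proof -
  have "wf_digraph (with_proj K)" "wf_digraph (with_proj H)"
    using assms by (unfold_locales; auto)+
  then show ?thesis
    using assms by (auto simp: is_subgraph_def subgraph_def compatible_def)
qed

lemma hom_count_single_edge:
  assumes T: "simple_graph T" and "a \<noteq> b"
  shows "hom_count \<lparr>pverts = {a, b}, parcs = {(a, b), (b, a)}\<rparr> T = card (parcs T)"
proof -
  note T' = simple_graphD[OF T]
  have "bij_betw (\<lambda>\<phi>. (\<phi> a, \<phi> b)) (homs \<lparr>pverts = {a, b}, parcs = {(a, b), (b, a)}\<rparr> T) (parcs T)"
  proof (rule bij_betw_byWitness[where f' = "\<lambda>p. \<lambda>x\<in>{a, b}. if x = a then fst p else snd p"])
    show "\<forall>\<phi>\<in>homs \<lparr>pverts = {a, b}, parcs = {(a, b), (b, a)}\<rparr> T.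
        (\<lambda>x\<in>{a, b}. if x = a then fst (\<phi> a, \<phi> b) else snd (\<phi> a, \<phi> b)) = \<phi>"
      by (auto simp: homs_def PiE_iff intro!: extensionalityI[of _ "{a, b}"])
  qed (use T'(5) assms(2) in \<open>auto simp: homs_def PiE_iff\<close>)
  then show ?thesis by (simp add: hom_count_homs bij_betw_same_card)
qed

lemma hom_density_single_edge:
  assumes "simple_graph T" "a \<noteq> b"
  shows "hom_density \<lparr>pverts = {a, b}, parcs = {(a, b), (b, a)}\<rparr> T = card (parcs T) / real (nverts T) ^ 2"
  using assms by (simp add: hom_density_def hom_count_single_edge nverts_def numeral_2_eq_2)

lemma hom_density_K2:
  "simple_graph T \<Longrightarrow> hom_density K2 T = card (parcs T) / real (nverts T) ^ 2"
  unfolding K2_def by (rule hom_density_single_edge) auto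

lemma finite_edges:
  assumes "simple_graph H"
  shows "finite (edges H)"
proof -
  have "edges H = (\<lambda>(x, y). {x, y}) ` parcs H" by (auto simp: edges_def)
  then show ?thesis using simple_graphD(2)[OF assms] by simp
qed

text \<open>Bounds the total weight by the number of edges, so that the supremum in
  \<open>fractional_matching_number\<close> is over a bounded set.\<close>

lemma fractional_matching_le_1:
  assumes H: "simple_graph H" and f: "fractional_matching H f" and e: "e \<in> edges H"
  shows "f e \<le> 1"
proof -
  obtain x y where xy: "e = {x, y}" "(x, y) \<in> parcs H" using e by (auto simp: edges_def)
  have "f e \<le> (\<Sum>e \<in> {e \<in> edges H. x \<in> e}. f e)"
    using f e xy finite_edges[OF H] by (intro member_le_sum) (auto simp: fractional_matching_def)
  also have "\<dots> \<le> 1"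
    using f simple_graphD(5)[OF H xy(2)] by (auto simp: fractional_matching_def)
  finally show ?thesis .
qed

lemma fractional_matching_number_upper:
  assumes H: "simple_graph H" and f: "fractional_matching H f"
  shows "(\<Sum>e \<in> edges H. f e) \<le> fractional_matching_number H"
  unfolding fractional_matching_number_def
proof (rule cSup_upper)
  show "bdd_above {\<Sum>e \<in> edges H. f e | f. fractional_matching H f}"
  proof (rule bdd_aboveI, safe)
    fix g assume g: "fractional_matching H g"
    show "(\<Sum>e \<in> edges H. g e) \<le> real (card (edges H))"
      using sum_bounded_above[of "edges H" g 1] fractional_matching_le_1[OF H g] by simp
  qed
qed (use f in auto)

text \<open>All weight goes on one edge. The resulting positivity is what allows division by the
  fractional matching number later.\<close>

lemma fractional_matching_number_ge_1:
  assumes H: "simple_graph H" and "edges H \<noteq> {}"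
  shows "1 \<le> fractional_matching_number H"
proof -
  obtain e where e: "e \<in> edges H" using assms(2) by blast
  define f where "f e' = (if e' = e then 1 else 0 :: real)" for e'
  have "fractional_matching H f"
    using finite_edges[OF H] by (auto simp: fractional_matching_def f_def)
  from fractional_matching_number_upper[OF H this] show ?thesis
    using e finite_edges[OF H] by (simp add: f_def)
qed

text \<open>For the single edges as subgraphs, a fractional packing is exactly a fractional
  matching.\<close>

lemma hom_density_le_K2_powr_matching:
  assumes H: "simple_graph H" and T: "simple_graph T" and f: "fractional_matching H f"
  shows "hom_density H T \<le> (\<Prod>e\<in>edges H. hom_density K2 T powr f e)"
proof -
  note H' = simple_graphD[OF H]
  define K where "K e = \<lparr>pverts = e, parcs = {(x, y) \<in> parcs H. x \<in> e \<and> y \<in> e}\<rparr>" for e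
  have "hom_density H T \<le> (\<Prod>e\<in>edges H. hom_density (K e) T powr f e)"
  proof (rule hom_density_le_fractional_packing[OF H'(1) T finite_edges[OF H]])
    show "is_subgraph (K e) H" if "e \<in> edges H" for e
      using that H'(4,5) by (intro is_subgraphI) (auto simp: K_def edges_def)
  qed (use f in \<open>auto simp: fractional_matching_def K_def\<close>)
  also have "hom_density (K e) T = hom_density K2 T" if e: "e \<in> edges H" for e
  proof -
    obtain a b where ab: "e = {a, b}" "(a, b) \<in> parcs H" using e by (auto simp: edges_def)
    have "a \<noteq> b" "(b, a) \<in> parcs H" using H'(5)[OF ab(2)] by auto
    moreover have "K e = \<lparr>pverts = {a, b}, parcs = {(a, b), (b, a)}\<rparr>"
      using ab H'(5) by (auto simp: K_def)
    ultimately show ?thesis by (simp add: hom_density_single_edge hom_density_K2 T)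
  qed
  then have "(\<Prod>e\<in>edges H. hom_density (K e) T powr f e) = (\<Prod>e\<in>edges H. hom_density K2 T powr f e)"
    by (intro prod.cong) auto
  finally show ?thesis .
qed

text \<open>After taking logarithms the bound for one matching reads
  \<open>s \<le> ln (hom_density H T) / ln t\<close>, because \<open>ln t < 0\<close>. It therefore
  passes to the supremum without a matching that attains it.\<close>

lemma hom_density_le_K2_powr_fractional_matching_number:
  assumes H: "simple_graph H" and ne: "edges H \<noteq> {}" and T: "simple_graph T"
  shows "hom_density H T \<le> hom_density K2 T powr fractional_matching_number H"
proof -
  define t where "t = hom_density K2 T"
  have finK2: "finite (pverts K2)" by (simp add: K2_def)
  consider "hom_density H T = 0" | "t = 0" | "t = 1" | "0 < hom_density H T" "0 < t" "t < 1"
    using hom_density_nonneg[of H T] hom_density_nonneg[of K2 T] hom_density_le_1[OF finK2 T]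
    unfolding t_def by linarith
  then show ?thesis
  proof cases
    case 2
    obtain e where e: "e \<in> edges H" using ne by blast
    \<comment> \<open>Here \<open>0 powr 0 = 0\<close> matters: already the zero matching gives a
      product over a nonempty edge set that vanishes.\<close>
    have "fractional_matching H (\<lambda>_. 0)" by (simp add: fractional_matching_def)
    from hom_density_le_K2_powr_matching[OF H T this] have "hom_density H T \<le> 0"
      using 2 e finite_edges[OF H] by (simp add: t_def[symmetric] prod_zero power_0_left card_gt_0_iff split: if_splits)
    then show ?thesis by (meson order_trans powr_ge_zero)
  next
    case 3
    then show ?thesis
      using hom_density_le_1[OF simple_graphD(1)[OF H] T] by (simp add: t_def)
  next
    case 4
    have "fractional_matching_number H \<le> ln (hom_density H T) / ln t"
      unfolding fractional_matching_number_def
    proof (rule cSup_least)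
      have "fractional_matching H (\<lambda>_. 0)" by (simp add: fractional_matching_def)
      then show "{\<Sum>e \<in> edges H. f e | f. fractional_matching H f} \<noteq> {}" by blast
      fix s assume "s \<in> {\<Sum>e \<in> edges H. f e | f. fractional_matching H f}"
      then obtain f where f: "fractional_matching H f" and s: "s = (\<Sum>e \<in> edges H. f e)" by blast
      have "hom_density H T \<le> t powr s"
        using hom_density_le_K2_powr_matching[OF H T f] 4 finite_edges[OF H]
        by (simp add: s powr_sum t_def[symmetric])
      then have "ln (hom_density H T) \<le> s * ln t"
        using 4 by (metis ln_powr ln_mono order_less_le_trans)
      then show "s \<le> ln (hom_density H T) / ln t"
        using 4 by (simp add: le_divide_eq)
    qed
    then have "ln (hom_density H T) \<le> fractional_matching_number H * ln t"
      using 4 by (simp add: le_divide_eq)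
    then have "exp (ln (hom_density H T)) \<le> exp (fractional_matching_number H * ln t)"
      by (simp only: exp_le_cancel_iff)
    then show ?thesis
      using 4 by (simp add: powr_def t_def)
  qed simp
qed

lemma sum_half_inj_fiber_le:
  assumes "inj_on g M" "finite M"
  shows "(\<Sum>m\<in>M. if g m = x then 1 / 2 else 0) \<le> (1 / 2 :: real)"
proof (cases "\<exists>m\<in>M. g m = x")
  case True
  then obtain m where m: "m \<in> M" "g m = x" by blast
  then have "(\<Sum>m'\<in>M. if g m' = x then 1 / 2 else 0) = (\<Sum>m'\<in>M. if m' = m then 1 / 2 else (0 :: real))"
    using assms(1) by (intro sum.cong refl) (auto dest: inj_onD)
  then show ?thesis using assms(2) m by simp
next
  case False
  then have "(\<Sum>m\<in>M. if g m = x then 1 / 2 else 0) = (\<Sum>m\<in>M. 0 :: real)"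
    by (intro sum.cong) auto
  then show ?thesis by simp
qed

text \<open>
  The fractional vertex cover of the LP dual appears as \<open>x \<mapsto> 1 - k x / 2\<close>; it comes from a minimum vertex
  cover of the bipartite double cover of \<open>H\<close>, whose arcs are \<open>parcs H\<close> itself.
\<close>

lemma half_integral_duality:
  assumes H: "simple_graph H"
  obtains k :: "'a \<Rightarrow> nat" where
    "\<And>x. k x \<le> 2" "\<And>x y. (x, y) \<in> parcs H \<Longrightarrow> k x + k y \<le> 2"
    "2 * real (nverts H) - 2 * fractional_matching_number H \<le> real (\<Sum>x\<in>pverts H. k x)"
proof -
  note H' = simple_graphD[OF H]
  obtain M X Y where M: "M \<subseteq> parcs H" "inj_on fst M" "inj_on snd M"
    and XY: "finite X" "finite Y" "parcs H \<subseteq> X \<times> UNIV \<union> UNIV \<times> Y" "card X + card Y \<le> card M"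
    using koenig[OF H'(2)] by blast
  have finM: "finite M" using M(1) H'(2) by (rule finite_subset)
  \<comment> \<open>Every arc of the matching gives 1/2 to its underlying edge. A vertex is the tail
    of at most one such arc and the head of at most one, so it receives at most 1.\<close>
  define f where "f e = (\<Sum>m\<in>M. if {fst m, snd m} = e then 1 / 2 else 0 :: real)" for e
  have fsum: "(\<Sum>e\<in>F. f e) = (\<Sum>m\<in>M. if {fst m, snd m} \<in> F then 1 / 2 else 0)" if "finite F" for F
    unfolding f_def by (subst sum.swap) (simp add: that)
  have edge: "{fst m, snd m} \<in> edges H" if "m \<in> M" for m
    using that M(1) by (cases m) (auto simp: edges_def)
  have "fractional_matching H f"
    unfolding fractional_matching_def
  proof safe
    show "0 \<le> f e" for e by (auto simp: f_def intro: sum_nonneg)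
    fix x
    have "(\<Sum>e \<in> {e \<in> edges H. x \<in> e}. f e) = (\<Sum>m\<in>M. if {fst m, snd m} \<in> {e \<in> edges H. x \<in> e} then 1 / 2 else 0)"
      using finite_edges[OF H] by (intro fsum) auto
    also have "\<dots> \<le> (\<Sum>m\<in>M. (if fst m = x then 1 / 2 else 0) + (if snd m = x then 1 / 2 else 0))"
      by (intro sum_mono) auto
    also have "\<dots> \<le> 1"
      using sum_half_inj_fiber_le[OF M(2) finM, of x] sum_half_inj_fiber_le[OF M(3) finM, of x]
      by (simp add: sum.distrib)
    finally show "(\<Sum>e \<in> {e \<in> edges H. x \<in> e}. f e) \<le> 1" .
  qed
  then have "(\<Sum>e\<in>edges H. f e) \<le> fractional_matching_number H"
    by (rule fractional_matching_number_upper[OF H])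
  moreover have "(\<Sum>e\<in>edges H. f e) = card M / 2"
    unfolding fsum[OF finite_edges[OF H]] using edge by simp
  ultimately have nu: "card M \<le> 2 * fractional_matching_number H" by simp
  \<comment> \<open>The number of the two copies of \<open>x\<close> in the double cover that lie
    outside the vertex cover.\<close>
  define k :: "'a \<Rightarrow> nat" where "k x = of_bool (x \<notin> X) + of_bool (x \<notin> Y)" for x
  have "(\<Sum>x\<in>pverts H. k x) + (card (pverts H \<inter> X) + card (pverts H \<inter> Y))
      = (\<Sum>x\<in>pverts H. k x + (of_bool (x \<in> X) + of_bool (x \<in> Y)))"
    using H'(1) by (simp add: sum.distrib Int_def)
  also have "\<dots> = (\<Sum>x\<in>pverts H. 2)"
    by (intro sum.cong) (auto simp: k_def)
  finally have "(\<Sum>x\<in>pverts H. k x) + (card (pverts H \<inter> X) + card (pverts H \<inter> Y)) = 2 * nverts H"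
    by (simp add: nverts_def)
  moreover have "card (pverts H \<inter> X) \<le> card X" "card (pverts H \<inter> Y) \<le> card Y"
    using XY by (auto intro: card_mono)
  ultimately have "2 * nverts H \<le> (\<Sum>x\<in>pverts H. k x) + card M"
    using XY(4) by linarith
  then have "real (2 * nverts H) \<le> real ((\<Sum>x\<in>pverts H. k x) + card M)"
    by (rule of_nat_mono)
  then have "2 * real (nverts H) - 2 * fractional_matching_number H \<le> real (\<Sum>x\<in>pverts H. k x)"
    using nu unfolding of_nat_add of_nat_mult by simp
  moreover have "k x + k y \<le> 2" if "(x, y) \<in> parcs H" for x y
  proof -
    \<comment> \<open>Both orientations of the edge are covered, so at least two of the four copies
      of its ends are in the cover.\<close>
    have "x \<in> X \<or> y \<in> Y" "y \<in> X \<or> x \<in> Y" using XY(3) that H'(5)[OF that] by auto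
    then show ?thesis by (auto simp: k_def)
  qed
  moreover have "k x \<le> 2" for x by (simp add: k_def)
  ultimately show ?thesis using that[of k] by blast
qed

section \<open>Extremal targets\<close>

definition clique_with_isolated :: "nat \<Rightarrow> nat \<Rightarrow> nat pair_pre_digraph" where
  "clique_with_isolated h m = \<lparr>pverts = {..<h * m}, parcs = {(i, j). i < h \<and> j < h \<and> i \<noteq> j}\<rparr>"

lemma nverts_clique_with_isolated: "nverts (clique_with_isolated h m) = h * m"
  by (simp add: nverts_def clique_with_isolated_def)

lemma simple_graph_clique_with_isolated:
  assumes "0 < h" "0 < m"
  shows "simple_graph (clique_with_isolated h m)"
proof -
  have "h \<le> h * m" using assms by simp
  then show ?thesis
    unfolding clique_with_isolated_def using assms
    by (intro simple_graphI) (auto simp: lessThan_empty_iff intro: less_le_trans)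
qed

text \<open>A vertex with a neighbour can only be mapped into the clique, which is a fraction
  \<open>1 / m\<close> of the target.\<close>

lemma hom_density_clique_with_isolated_le:
  assumes G: "finite (pverts G)" "no_isolated_vertex G" and pos: "0 < h" "0 < m"
  shows "hom_density G (clique_with_isolated h m) \<le> 1 * real m powr - real (nverts G)"
proof -
  have "homs G (clique_with_isolated h m) \<subseteq> pverts G \<rightarrow>\<^sub>E {..<h}"
  proof (rule subsetI)
    fix \<phi> assume \<phi>: "\<phi> \<in> homs G (clique_with_isolated h m)"
    have "\<phi> x < h" if x: "x \<in> pverts G" for x
    proof -
      obtain y where "(x, y) \<in> parcs G" using G(2) x unfolding no_isolated_vertex_def by blast
      then have "(\<phi> x, \<phi> y) \<in> parcs (clique_with_isolated h m)" 
        using \<phi> by (rule homsD(2)[rotated])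
      then show ?thesis by (simp add: clique_with_isolated_def)
    qed
    then show "\<phi> \<in> pverts G \<rightarrow>\<^sub>E {..<h}"
      using PiE_arb[OF homsD(1)[OF \<phi>]] by (intro PiE_I) auto
  qed
  then have "card (homs G (clique_with_isolated h m)) \<le> card (pverts G \<rightarrow>\<^sub>E {..<h})"
    using G by (intro card_mono finite_PiE) auto
  then have "hom_count G (clique_with_isolated h m) \<le> h ^ nverts G"
    using G by (simp add: hom_count_homs card_funcsetE nverts_def)
  then have "real (hom_count G (clique_with_isolated h m)) \<le> real h ^ nverts G"
    by (metis of_nat_mono of_nat_power)
  then have "hom_density G (clique_with_isolated h m) \<le> real h ^ nverts G / real (h * m) ^ nverts G"
    unfolding hom_density_def nverts_clique_with_isolated by (rule divide_right_mono) simp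
  also have "\<dots> = real m powr - real (nverts G)"
    using pos by (simp add: power_mult_distrib powr_minus powr_realpow inverse_eq_divide)
  finally show ?thesis by simp
qed

text \<open>A single injective map into the clique suffices, since \<open>h\<close> is fixed while
  \<open>m\<close> grows.\<close>

lemma hom_density_clique_with_isolated_ge:
  assumes H: "simple_graph H" and h: "h = nverts H" and m: "0 < m"
  shows "(1 / real h ^ h) * real m powr - real h \<le> hom_density H (clique_with_isolated h m)"
proof -
  note H' = simple_graphD[OF H]
  have hm: "h \<le> h * m" using m by simp
  obtain idx where "bij_betw idx (pverts H) {0..<card (pverts H)}"
    using ex_bij_betw_finite_nat[OF H'(1)] by blast
  then have idx: "inj_on idx (pverts H)" "\<And>x. x \<in> pverts H \<Longrightarrow> idx x < h"
    by (auto simp: bij_betw_def h nverts_def)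
  have "restrict idx (pverts H) \<in> homs H (clique_with_isolated h m)"
  proof -
    have "idx x < h \<and> idx y < h \<and> idx x \<noteq> idx y \<and> x \<in> pverts H \<and> y \<in> pverts H" if "(x, y) \<in> parcs H" for x y
      using H'(5)[OF that] idx by (auto dest: inj_onD)
    moreover have "idx x < h * m" if "x \<in> pverts H" for x
      using idx(2)[OF that] hm by (rule less_le_trans)
    ultimately show ?thesis by (auto simp: homs_def clique_with_isolated_def)
  qed
  moreover have "finite (homs H (clique_with_isolated h m))"
    by (rule finite_homs[OF H'(1)]) (simp add: clique_with_isolated_def)
  ultimately have "0 < hom_count H (clique_with_isolated h m)"
    by (auto simp: hom_count_homs card_gt_0_iff)
  then have "1 \<le> real (hom_count H (clique_with_isolated h m))" by simp
  then have "1 / real (h * m) ^ h \<le> hom_density H (clique_with_isolated h m)"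
    unfolding hom_density_def h[symmetric] nverts_clique_with_isolated by (rule divide_right_mono) simp
  moreover have "1 / real (h * m) ^ h = (1 / real h ^ h) * real m powr - real h"
    using m by (simp add: power_mult_distrib powr_minus powr_realpow inverse_eq_divide)
  ultimately show ?thesis by simp
qed

lemma domination_exponent_ge_nverts_ratio:
  assumes G: "simple_graph G" "no_isolated_vertex G" and H: "simple_graph H"
    and c: "c \<in> domination_exponents G H"
  shows "real (nverts G) / real (nverts H) \<le> c"
proof -
  define h where "h = nverts H"
  have h: "0 < h" using simple_graphD(3)[OF H] by (simp add: h_def)
  have "real (nverts G) \<le> c * real h"
  proof (rule domination_exponent_lower_bound[OF c simple_graphD(1)[OF H]])
    show "simple_graph (clique_with_isolated h m)" if "0 < m" for m
      using h that by (rule simple_graph_clique_with_isolated)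
    show "hom_density G (clique_with_isolated h m) \<le> 1 * real m powr - real (nverts G)" if "0 < m" for m
      using simple_graphD(1)[OF G(1)] G(2) h that by (rule hom_density_clique_with_isolated_le)
    show "(1 / real h ^ h) * real m powr - real h \<le> hom_density H (clique_with_isolated h m)" if "0 < m" for m
      using H h_def that by (rule hom_density_clique_with_isolated_ge)
  qed (use h simple_graphD(3)[OF G(1)] in auto)
  then show ?thesis using h by (simp add: h_def divide_le_eq)
qed

text \<open>
  With \<open>N = h * m\<^sup>2\<close> vertices, the sets \<open>{..<h * m ^ a}\<close> have relative size \<open>m powr (a - 2)\<close>, and two of them are
  completely joined when the product of their relative sizes is \<open>m powr -2\<close>. Vertices of \<open>H\<close> of
  cover weight \<open>1 - a / 2\<close> can be mapped to \<open>{..<h * m ^ a}\<close>.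
\<close>

definition threshold_target :: "nat \<Rightarrow> nat \<Rightarrow> nat pair_pre_digraph" where
  "threshold_target h m = \<lparr>pverts = {..<h * m ^ 2},
     parcs = {(i, j). i \<noteq> j \<and> (\<exists>a\<le>2. i < h * m ^ a \<and> j < h * m ^ (2 - a))}\<rparr>"

lemma nverts_threshold_target: "nverts (threshold_target h m) = h * m ^ 2"
  by (simp add: nverts_def threshold_target_def)

lemma simple_graph_threshold_target:
  assumes "0 < h" "0 < m"
  shows "simple_graph (threshold_target h m)"
  unfolding threshold_target_def
proof (rule simple_graphI)
  have *: "h * m ^ a \<le> h * m ^ 2" if "a \<le> 2" for a
    using assms that by (simp add: power_increasing)
  show "{(i, j). i \<noteq> j \<and> (\<exists>a\<le>2. i < h * m ^ a \<and> j < h * m ^ (2 - a))} \<subseteq> {..<h * m ^ 2} \<times> {..<h * m ^ 2}"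
    using * by (auto intro: less_le_trans)
  fix i j assume "(i, j) \<in> {(i, j). i \<noteq> j \<and> (\<exists>a\<le>2. i < h * m ^ a \<and> j < h * m ^ (2 - a))}"
  then obtain a where "i \<noteq> j" "a \<le> 2" "i < h * m ^ a" "j < h * m ^ (2 - a)" by blast
  then have "i \<noteq> j" "2 - a \<le> 2" "j < h * m ^ (2 - a)" "i < h * m ^ (2 - (2 - a))" by simp_all
  then show "i \<noteq> j \<and> (j, i) \<in> {(i, j). i \<noteq> j \<and> (\<exists>a\<le>2. i < h * m ^ a \<and> j < h * m ^ (2 - a))}"
    by blast
qed (use assms in \<open>auto simp: lessThan_empty_iff\<close>)

lemma hom_density_K2_threshold_target_le:
  assumes "0 < h" "0 < m"
  shows "hom_density K2 (threshold_target h m) \<le> 3 * real m powr - 2"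
proof -
  \<comment> \<open>One rectangle for each of the three values of \<open>a\<close>, each with
    \<open>h ^ 2 * m ^ 2\<close> pairs.\<close>
  have "parcs (threshold_target h m) \<subseteq> (\<Union>a\<in>{..2}. {..<h * m ^ a} \<times> {..<h * m ^ (2 - a)})"
    by (auto simp: threshold_target_def)
  then have "card (parcs (threshold_target h m)) \<le> card (\<Union>a\<in>{..2::nat}. {..<h * m ^ a} \<times> {..<h * m ^ (2 - a)})"
    by (intro card_mono) auto
  also have "\<dots> \<le> (\<Sum>a\<in>{..2::nat}. card ({..<h * m ^ a} \<times> {..<h * m ^ (2 - a)}))"
    by (intro card_UN_le) auto
  also have "\<dots> = (\<Sum>a\<in>{..2::nat}. h ^ 2 * m ^ 2)"
    by (intro sum.cong refl) (simp add: power2_eq_square mult_ac flip: power_add)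
  finally have "real (card (parcs (threshold_target h m))) \<le> real (3 * (h ^ 2 * m ^ 2))"
    by (intro of_nat_mono) simp
  then have "hom_density K2 (threshold_target h m) \<le> real (3 * (h ^ 2 * m ^ 2)) / real (h * m ^ 2) ^ 2"
    unfolding hom_density_K2[OF simple_graph_threshold_target[OF assms]] nverts_threshold_target
    by (rule divide_right_mono) simp
  also have "\<dots> = 3 * real m powr - 2"
    using assms by (simp add: powr_minus powr_numeral field_simps power2_eq_square)
  finally show ?thesis .
qed

text \<open>Each vertex \<open>x\<close> is sent into \<open>{..<h * m ^ k x}\<close> with
  \<open>m ^ k x\<close> free choices. The inequality \<open>k x + k y \<le> 2\<close> along arcs
  makes all these maps homomorphisms.\<close>

lemma hom_density_threshold_target_ge:
  assumes H: "simple_graph H" and h: "h = nverts H" and m: "0 < m"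
  shows "(1 / real h ^ h) * real m powr - (2 * fractional_matching_number H)
    \<le> hom_density H (threshold_target h m)"
proof -
  note H' = simple_graphD[OF H]
  obtain k :: "'a \<Rightarrow> nat" where k: "\<And>x. k x \<le> 2" "\<And>x y. (x, y) \<in> parcs H \<Longrightarrow> k x + k y \<le> 2"
    "2 * real (nverts H) - 2 * fractional_matching_number H \<le> real (\<Sum>x\<in>pverts H. k x)"
    using half_integral_duality[OF H] by blast
  obtain idx where "bij_betw idx (pverts H) {0..<card (pverts H)}"
    using ex_bij_betw_finite_nat[OF H'(1)] by blast
  then have idx: "inj_on idx (pverts H)" "\<And>x. x \<in> pverts H \<Longrightarrow> idx x < h"
    by (auto simp: bij_betw_def h nverts_def)
  define P where "P = (\<Pi>\<^sub>E x\<in>pverts H. {..<m ^ k x})"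
  \<comment> \<open>The residue modulo \<open>h\<close> is the index of \<open>x\<close>, so
    distinct vertices never collide; the quotient \<open>j x\<close> is the free choice and is
    recovered by \<open>div\<close>.\<close>
  define F where "F j = (\<lambda>x\<in>pverts H. idx x + h * j x)" for j :: "'a \<Rightarrow> nat"
  have Fless: "F j x < h * m ^ k x" if "j \<in> P" "x \<in> pverts H" for j x
  proof -
    have "F j x < h * Suc (j x)" using idx(2)[OF that(2)] that by (simp add: F_def)
    also have "\<dots> \<le> h * m ^ k x" using that by (intro mult_le_mono2) (auto simp: P_def PiE_iff Suc_le_eq)
    finally show ?thesis .
  qed
  have Fmod: "F j x mod h = idx x" and Fdiv: "F j x div h = j x" if "x \<in> pverts H" for j x
    using idx(2)[OF that] that by (simp_all add: F_def)
  have "F ` P \<subseteq> homs H (threshold_target h m)"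
  proof (rule image_subsetI)
    fix j assume j: "j \<in> P"
    have "F j \<in> pverts H \<rightarrow>\<^sub>E pverts (threshold_target h m)"
    proof (rule PiE_I)
      fix x assume x: "x \<in> pverts H"
      have "F j x < h * m ^ k x" using j x by (rule Fless)
      also have "\<dots> \<le> h * m ^ 2" using k(1) m by (simp add: power_increasing)
      finally show "F j x \<in> pverts (threshold_target h m)" by (simp add: threshold_target_def)
    qed (simp add: F_def)
    moreover have "(F j x, F j y) \<in> parcs (threshold_target h m)" if xy: "(x, y) \<in> parcs H" for x y
    proof -
      have v: "x \<in> pverts H" "y \<in> pverts H" "x \<noteq> y" using H'(5)[OF xy] by auto
      have "F j x \<noteq> F j y" using v Fmod idx(1) by (metis inj_onD)
      moreover have "F j y < h * m ^ k y" using j v by (intro Fless)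
      then have "F j y < h * m ^ (2 - k x)"
        by (rule less_le_trans) (use k(2)[OF xy] m in \<open>simp add: power_increasing\<close>)
      ultimately show ?thesis
        using Fless[OF j v(1)] k(1)[of x] by (auto simp: threshold_target_def)
    qed
    ultimately show "F j \<in> homs H (threshold_target h m)" by (auto simp: homs_def)
  qed
  moreover have "inj_on F P"
  proof (rule inj_onI)
    fix i j assume ij: "i \<in> P" "j \<in> P" "F i = F j"
    show "i = j"
      using ij(1,2) unfolding P_def
    proof (rule PiE_ext)
      show "i x = j x" if "x \<in> pverts H" for x using Fdiv[OF that] ij(3) by metis
    qed
  qed
  ultimately have "card P \<le> hom_count H (threshold_target h m)"
    unfolding hom_count_homs
    by (intro card_inj_on_le[of F] finite_homs H'(1)) (auto simp: threshold_target_def)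
  moreover have "card P = m ^ (\<Sum>x\<in>pverts H. k x)"
    using H'(1) by (simp add: P_def card_PiE power_sum)
  ultimately have count: "real m ^ (\<Sum>x\<in>pverts H. k x) \<le> real (hom_count H (threshold_target h m))"
    by (simp flip: of_nat_power)
  \<comment> \<open>By \<open>k(3)\<close> the sum of the \<open>k x\<close>, minus
    \<open>2 * h\<close>, is at least minus twice the fractional matching number.\<close>
  have "(1 / real h ^ h) * real m powr - (2 * fractional_matching_number H)
      \<le> (1 / real h ^ h) * real m powr (real (\<Sum>x\<in>pverts H. k x) - 2 * real h)"
    using k(3) m by (intro mult_left_mono powr_mono) (auto simp: h)
  also have "\<dots> = real m ^ (\<Sum>x\<in>pverts H. k x) / real (h * m ^ 2) ^ h"
  proof -
    have "real m powr (2 * real h) = (real m ^ 2) ^ h"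
      using powr_realpow[of "real m" "2 * h"] m by (simp add: power_mult)
    then show ?thesis
      using m by (simp add: powr_diff powr_realpow power_mult_distrib del: of_nat_sum)
  qed
  also have "\<dots> \<le> real (hom_count H (threshold_target h m)) / real (h * m ^ 2) ^ h"
    using count by (rule divide_right_mono) simp
  also have "\<dots> = hom_density H (threshold_target h m)"
    unfolding hom_density_def h[symmetric] nverts_threshold_target ..
  finally show ?thesis .
qed

text \<open>The form of the hypothesis on \<open>G\<close> serves both \<open>K2\<close> itself,
  with \<open>a = 1\<close>, and any graph with an edge, with \<open>a\<close> its fractional
  matching number.\<close>

lemma domination_exponent_ge_matching_ratio:
  assumes G: "0 < a" "\<And>T :: nat pair_pre_digraph. simple_graph T \<Longrightarrow> hom_density G T \<le> hom_density K2 T powr a"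
    and H: "simple_graph H" and ne: "edges H \<noteq> {}" and c: "c \<in> domination_exponents G H"
  shows "a / fractional_matching_number H \<le> c"
proof -
  define h where "h = nverts H"
  have h: "0 < h" using simple_graphD(3)[OF H] by (simp add: h_def)
  have "2 * a \<le> c * (2 * fractional_matching_number H)"
  proof (rule domination_exponent_lower_bound[OF c simple_graphD(1)[OF H]])
    show T: "simple_graph (threshold_target h m)" if "0 < m" for m
      using h that by (rule simple_graph_threshold_target)
    show "hom_density G (threshold_target h m) \<le> (3 powr a) * real m powr - (2 * a)" if "0 < m" for m
    proof -
      have "hom_density G (threshold_target h m) \<le> hom_density K2 (threshold_target h m) powr a"
        using T[OF that] by (rule G(2))
      also have "\<dots> \<le> (3 * real m powr - 2) powr a"
        using hom_density_K2_threshold_target_le[OF h that] G(1)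
        by (intro powr_mono2) (auto simp: hom_density_nonneg)
      also have "\<dots> = (3 powr a) * real m powr - (2 * a)"
        using that by (simp add: powr_mult powr_powr)
      finally show ?thesis .
    qed
    show "(1 / real h ^ h) * real m powr - (2 * fractional_matching_number H)
        \<le> hom_density H (threshold_target h m)" if "0 < m" for m
      using H h_def that by (rule hom_density_threshold_target_ge)
  qed (use h G(1) in auto)
  then show ?thesis
    using fractional_matching_number_ge_1[OF H ne] by (simp add: divide_le_eq)
qed

section \<open>Domination exponents\<close>

lemma card_subsets_containing:
  assumes V: "finite V" and v: "v \<in> V" and k: "0 < k"
  shows "card {S. S \<subseteq> V \<and> card S = k \<and> v \<in> S} = (card V - 1) choose (k - 1)"
proof -
  have "bij_betw (insert v) {S. S \<subseteq> V - {v} \<and> card S = k - 1} {S. S \<subseteq> V \<and> card S = k \<and> v \<in> S}"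
  proof (rule bij_betw_byWitness[where f' = "\<lambda>S. S - {v}"])
    show "insert v ` {S. S \<subseteq> V - {v} \<and> card S = k - 1} \<subseteq> {S. S \<subseteq> V \<and> card S = k \<and> v \<in> S}"
    proof (rule image_subsetI)
      fix S assume S: "S \<in> {S. S \<subseteq> V - {v} \<and> card S = k - 1}"
      then have "finite S" "v \<notin> S" using V by (auto intro: finite_subset)
      then show "insert v S \<in> {S. S \<subseteq> V \<and> card S = k \<and> v \<in> S}" using S v k by auto
    qed
  qed auto
  then have "card {S. S \<subseteq> V \<and> card S = k \<and> v \<in> S} = card {S. S \<subseteq> V - {v} \<and> card S = k - 1}"
    by (simp add: bij_betw_same_card)
  also have "\<dots> = (card V - 1) choose (k - 1)"
    using V v by (simp add: n_subsets)
  finally show ?thesis .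
qed

text \<open>Every vertex of \<open>H2\<close> lies in \<open>b = (n - 1) choose (k - 1)\<close> of
  the \<open>k\<close>-subsets, so the weights \<open>1 / b\<close> form a fractional packing. Their
  total is \<open>(n choose k) / b = n / k\<close>.\<close>

lemma hom_density_le_powr_of_copies:
  assumes H1: "simple_graph H1" and H2: "simple_graph H2" and le: "nverts H1 \<le> nverts H2"
    and copies: "\<And>S. S \<subseteq> pverts H2 \<Longrightarrow> card S = nverts H1 \<Longrightarrow> contains_copy H2 S H1"
    and T: "simple_graph T"
  shows "hom_density H2 T \<le> hom_density H1 T powr (real (nverts H2) / real (nverts H1))"
proof -
  define n k where "n = nverts H2" and "k = nverts H1"
  have k: "0 < k" "k \<le> n" using simple_graphD(3)[OF H1] le by (simp_all add: n_def k_def)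
  note V = simple_graphD(1)[OF H2]
  define J where "J = {S. S \<subseteq> pverts H2 \<and> card S = k}"
  have J: "finite J" using V by (auto simp: J_def)
  have cardJ: "card J = n choose k" using V by (simp add: J_def n_subsets n_def nverts_def)
  have "\<exists>K. is_subgraph K H2 \<and> pverts K = S \<and> isomorphic H1 K" if S: "S \<in> J" for S
  proof -
    obtain K where K: "is_subgraph K H2" "pverts K \<subseteq> S" "isomorphic H1 K"
      using copies[of S] S by (auto simp: J_def k_def contains_copy_def)
    have "finite S" using S V by (auto simp: J_def intro: finite_subset)
    moreover have "card (pverts K) = card S"
      using isomorphic_nverts[OF K(3)] S by (simp add: J_def k_def nverts_def)
    ultimately have "pverts K = S" using K(2) by (metis card_subset_eq)
    with K show ?thesis by blast
  qed
  then obtain K where K: "\<And>S. S \<in> J \<Longrightarrow> is_subgraph (K S) H2" "\<And>S. S \<in> J \<Longrightarrow> pverts (K S) = S"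
    "\<And>S. S \<in> J \<Longrightarrow> isomorphic H1 (K S)"
    by metis
  define b where "b = (n - 1) choose (k - 1)"
  have b: "0 < b" using k by (simp add: b_def)
  have "hom_density H2 T \<le> (\<Prod>S\<in>J. hom_density (K S) T powr (1 / real b))"
  proof (rule hom_density_le_fractional_packing[OF V T J K(1)])
    fix v assume v: "v \<in> pverts H2"
    have "{S. S \<in> J \<and> v \<in> pverts (K S)} = {S. S \<subseteq> pverts H2 \<and> card S = k \<and> v \<in> S}"
      using K(2) by (auto simp: J_def)
    then have "card {S. S \<in> J \<and> v \<in> pverts (K S)} = b"
      using card_subsets_containing[OF V v k(1)] by (simp add: b_def n_def nverts_def)
    then show "(\<Sum>S | S \<in> J \<and> v \<in> pverts (K S). 1 / real b) \<le> 1"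
      using b by simp
  qed auto
  \<comment> \<open>Since \<open>k \<le> n\<close>, the number of factors is positive, so both sides
    vanish when the density is 0.\<close>
  also have "\<dots> = (\<Prod>S\<in>J. hom_density H1 T powr (1 / real b))"
    by (intro prod.cong refl) (simp add: isomorphic_hom_density[OF K(3), symmetric])
  also have "\<dots> = hom_density H1 T powr (1 / real b * real (n choose k))"
    unfolding prod_constant cardJ using k(2)
    by (cases "hom_density H1 T = 0") (simp_all add: powr_power)
  also have "1 / real b * real (n choose k) = real n / real k"
  proof -
    have "real k * real (n choose k) = real n * real b"
      unfolding b_def of_nat_mult[symmetric] using times_binomial_minus1_eq[OF k(1), of n] by simp
    then show ?thesis using b k by (simp add: field_simps)
  qed
  finally show ?thesis by (simp add: n_def k_def)
qed

theorem domination_exponent_copies: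
  assumes H1: "simple_graph H1" "no_isolated_vertex H1" and H2: "simple_graph H2"
    and le: "nverts H1 \<le> nverts H2"
    and copies: "\<And>S. S \<subseteq> pverts H2 \<Longrightarrow> card S = nverts H1 \<Longrightarrow> contains_copy H2 S H1"
  shows "has_domination_exponent H1 H2 (real (nverts H1) / real (nverts H2))"
proof -
  have "0 < real (nverts H2) / real (nverts H1)"
    using simple_graphD(3)[OF H1(1)] simple_graphD(3)[OF H2] by simp
  from mem_domination_exponentsI[OF this hom_density_le_powr_of_copies[OF H1(1) H2 le copies]]
  have "real (nverts H1) / real (nverts H2) \<in> domination_exponents H1 H2"
    by simp
  then show ?thesis
    using domination_exponent_ge_nverts_ratio[OF H1 H2] by (simp add: has_domination_exponent_def)
qed

text \<open>Disjoint paths form a packing with all weights 1. Cubing the resulting product and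
  comparing each path with \<open>path_graph 2\<close> gives the exponent
  \<open>\<Sum>i. l i + 1\<close>, which is the number of vertices of \<open>H\<close>.\<close>

theorem domination_exponent_path_partition:
  fixes P :: "nat \<Rightarrow> 'c pair_pre_digraph"
  assumes H: "simple_graph H"
    and P: "\<And>i. i \<in> {1..k} \<Longrightarrow> 2 \<le> l i" "\<And>i. i \<in> {1..k} \<Longrightarrow> is_subgraph (P i) H"
      "\<And>i. i \<in> {1..k} \<Longrightarrow> isomorphic (path_graph (l i)) (P i)"
    and disj: "disjoint_family_on (\<lambda>i. pverts (P i)) {1..k}"
    and V: "pverts H = (\<Union>i \<in> {1..k}. pverts (P i))"
  shows "has_domination_exponent (path_graph 2) H (3 / real (nverts H))"
proof -
  note H' = simple_graphD[OF H]
  have cardP: "card (pverts (P i)) = l i + 1" if "i \<in> {1..k}" for i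
    using isomorphic_nverts[OF P(3)[OF that]] unfolding nverts_path_graph by (simp add: nverts_def)
  have "nverts H = (\<Sum>i\<in>{1..k}. card (pverts (P i)))"
    unfolding nverts_def V
    using disj finite_subset[OF is_subgraphD(1)[OF P(2)] H'(1)]
    by (intro card_UN_disjoint) (auto simp: disjoint_family_on_def)
  then have n: "nverts H = (\<Sum>i\<in>{1..k}. l i + 1)" using cardP by simp
  have "hom_density H T \<le> hom_density (path_graph 2) T powr (real (nverts H) / 3)"
    if T: "simple_graph T" for T :: "nat pair_pre_digraph"
  proof -
    define p where "p = hom_density (path_graph 2) T"
    have p0: "0 \<le> p" by (simp add: p_def hom_density_nonneg)
    have "hom_density H T \<le> (\<Prod>i\<in>{1..k}. hom_density (P i) T powr 1)"
    proof (rule hom_density_le_fractional_packing[OF H'(1) T])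
      fix v assume "v \<in> pverts H"
      then obtain i where i: "i \<in> {1..k}" "v \<in> pverts (P i)" using V by auto
      then have "{j. j \<in> {1..k} \<and> v \<in> pverts (P j)} = {i}"
        using disj by (fastforce simp: disjoint_family_on_def)
      then show "(\<Sum>j | j \<in> {1..k} \<and> v \<in> pverts (P j). 1 :: real) \<le> 1" by simp
    qed (use P in auto)
    also have "\<dots> = (\<Prod>i\<in>{1..k}. hom_density (path_graph (l i)) T)"
      by (intro prod.cong refl) (simp add: isomorphic_hom_density[OF P(3), symmetric] hom_density_nonneg)
    finally have "hom_density H T ^ 3 \<le> (\<Prod>i\<in>{1..k}. hom_density (path_graph (l i)) T) ^ 3"
      by (intro power_mono hom_density_nonneg)
    also have "\<dots> = (\<Prod>i\<in>{1..k}. hom_density (path_graph (l i)) T ^ 3)"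
      by (simp add: prod_power_distrib)
    also have "\<dots> \<le> (\<Prod>i\<in>{1..k}. p ^ (l i + 1))"
      unfolding p_def using hom_density_path_cube_le[OF T P(1)]
      by (intro prod_mono) (auto simp: hom_density_nonneg)
    also have "\<dots> = p ^ nverts H"
      by (simp add: n power_sum)
    finally have cube: "hom_density H T ^ 3 \<le> p ^ nverts H" .
    have "p ^ nverts H = (p powr (real (nverts H) / 3)) ^ 3"
    proof (cases "p = 0")
      case False
      then have "(p powr (real (nverts H) / 3)) ^ 3 = p powr real (nverts H)"
        by (simp add: powr_power)
      with False p0 show ?thesis by (simp add: powr_realpow)
    qed (use H'(3) in simp)
    with cube have "hom_density H T ^ Suc 2 \<le> (p powr (real (nverts H) / 3)) ^ Suc 2" by simp
    then show ?thesis unfolding p_def by (rule power_le_imp_le_base) simp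
  qed
  from mem_domination_exponentsI[OF _ this] have "3 / real (nverts H) \<in> domination_exponents (path_graph 2) H"
    using H'(3) by simp
  moreover have "3 / real (nverts H) \<le> c" if "c \<in> domination_exponents (path_graph 2) H" for c
  proof -
    have "no_isolated_vertex (path_graph 2)"
      unfolding no_isolated_vertex_def
    proof
      fix x assume "x \<in> pverts (path_graph 2)"
      then have "(x, if x = 0 then 1 else x - 1) \<in> parcs (path_graph 2)" by (auto simp: path_graph_def)
      then show "\<exists>y. (x, y) \<in> parcs (path_graph 2)" by blast
    qed
    from domination_exponent_ge_nverts_ratio[OF simple_graph_path_graph this H that]
    show ?thesis by (simp add: nverts_path_graph)
  qed
  ultimately show ?thesis by (simp add: has_domination_exponent_def)
qed

theorem domination_exponent_K2:
  assumes H: "simple_graph H" and ne: "edges H \<noteq> {}"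
  shows "has_domination_exponent K2 H (inverse (fractional_matching_number H))"
proof -
  have pos: "0 < fractional_matching_number H"
    using fractional_matching_number_ge_1[OF H ne] by simp
  have "inverse (fractional_matching_number H) \<in> domination_exponents K2 H"
    using pos hom_density_le_K2_powr_fractional_matching_number[OF H ne] by (rule mem_domination_exponentsI)
  moreover have "inverse (fractional_matching_number H) \<le> c" if "c \<in> domination_exponents K2 H" for c
    using domination_exponent_ge_matching_ratio[of 1 K2, OF _ _ H ne that]
    by (simp add: hom_density_nonneg inverse_eq_divide)
  ultimately show ?thesis by (simp add: has_domination_exponent_def)
qed

theorem domination_exponent_subgraph:
  assumes H1: "simple_graph H1" and H2: "simple_graph H2" and ne: "edges H1 \<noteq> {}"
    and sub: "is_subgraph H1 H2"
    and nu: "fractional_matching_number H1 = fractional_matching_number H2"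
  shows "has_domination_exponent H1 H2 1"
proof -
  have "edges H1 \<subseteq> edges H2" using is_subgraphD(2)[OF sub] by (auto simp: edges_def)
  with ne have ne2: "edges H2 \<noteq> {}" by blast
  have pos: "0 < fractional_matching_number H1"
    using fractional_matching_number_ge_1[OF H1 ne] by simp
  have "hom_density H2 T \<le> hom_density H1 T powr 1" if "simple_graph T" for T :: "nat pair_pre_digraph"
    \<comment> \<open>The packing consists of the one subgraph \<open>H1\<close> with weight
      1.\<close>
    using hom_density_le_fractional_packing[OF simple_graphD(1)[OF H2] that, of "{()}" "\<lambda>_. H1" "\<lambda>_. 1"] sub
    by simp
  from mem_domination_exponentsI[OF _ this] have "1 \<in> domination_exponents H1 H2" by simp
  moreover have "1 \<le> c" if "c \<in> domination_exponents H1 H2" for c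
    using domination_exponent_ge_matching_ratio[OF pos
        hom_density_le_K2_powr_fractional_matching_number[OF H1 ne] H2 ne2 that] pos
    by (simp add: nu)
  ultimately show ?thesis by (simp add: has_domination_exponent_def)
qed

theorem theorem5p1:
  shows
    "(\<forall>(H1 :: 'a pair_pre_digraph) (H2 :: 'b pair_pre_digraph).
        simple_graph H1 \<and> simple_graph H2 \<and> no_isolated_vertex H1 \<and> nverts H1 \<le> nverts H2 \<and>
        (\<forall>S \<subseteq> pverts H2. card S = nverts H1 \<longrightarrow> contains_copy H2 S H1)
        \<longrightarrow> has_domination_exponent H1 H2 (real (nverts H1) / real (nverts H2))) \<and>
     (\<forall>H :: 'c pair_pre_digraph.
        simple_graph H \<and>
        (\<exists>(k :: nat) (l :: nat \<Rightarrow> nat) (P :: nat \<Rightarrow> 'c pair_pre_digraph).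
           (\<forall>i \<in> {1..k}. l i \<ge> 2 \<and> is_subgraph (P i) H \<and> isomorphic (path_graph (l i)) (P i)) \<and>
           disjoint_family_on (\<lambda>i. pverts (P i)) {1..k} \<and>
           pverts H = (\<Union>i \<in> {1..k}. pverts (P i)))
        \<longrightarrow> has_domination_exponent (path_graph 2) H (3 / real (nverts H))) \<and>
     (\<forall>H :: 'd pair_pre_digraph.
        simple_graph H \<and> edges H \<noteq> {}
        \<longrightarrow> has_domination_exponent K2 H (inverse (fractional_matching_number H))) \<and>
     (\<forall>(H1 :: 'e pair_pre_digraph) (H2 :: 'e pair_pre_digraph).
        simple_graph H1 \<and> simple_graph H2 \<and> edges H1 \<noteq> {} \<and> is_subgraph H1 H2 \<and>
        fractional_matching_number H1 = fractional_matching_number H2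
        \<longrightarrow> has_domination_exponent H1 H2 1)"
proof (intro conjI allI impI; elim conjE exE)
  fix H1 :: "'a pair_pre_digraph" and H2 :: "'b pair_pre_digraph"
  assume "simple_graph H1" "simple_graph H2" "no_isolated_vertex H1" "nverts H1 \<le> nverts H2"
    "\<forall>S \<subseteq> pverts H2. card S = nverts H1 \<longrightarrow> contains_copy H2 S H1"
  then show "has_domination_exponent H1 H2 (real (nverts H1) / real (nverts H2))"
    by (intro domination_exponent_copies) auto
next
  fix H :: "'c pair_pre_digraph" and k l and P :: "nat \<Rightarrow> 'c pair_pre_digraph"
  assume "simple_graph H" "disjoint_family_on (\<lambda>i. pverts (P i)) {1..k}"
    "pverts H = (\<Union>i \<in> {1..k}. pverts (P i))"
    "\<forall>i \<in> {1..k}. l i \<ge> 2 \<and> is_subgraph (P i) H \<and> isomorphic (path_graph (l i)) (P i)"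
  then show "has_domination_exponent (path_graph 2) H (3 / real (nverts H))"
    by (intro domination_exponent_path_partition[where P = P and l = l and k = k]) auto
qed (simp_all add: domination_exponent_K2 domination_exponent_subgraph)

end
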